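(* Let $p=q=1/2$. For a circular table for $n$ people, let $o$ be the number of napkinless guests, $m$ the number of frustrated guests, and $h=n-o-m$ the number of happy guests, and let $E_n$, $\mathrm{Var}_n$, $\mathrm{Cov}_n$ denote expectation, variance and covariance. Then, as $n\to\infty$, $$E_n(o)\sim n(2-\sqrt e)^2,\qquad E_n(m)\sim n(6\sqrt e-e-7),\qquad E_n(h)\sim n(4-2\sqrt e),$$ $$\mathrm{Var}_n(o)\sim n(3-e)(2-\sqrt e)^2,\qquad \mathrm{Var}_n(m)\sim n\big(6\sqrt{e^3}-e^2-e-38\sqrt e+46\big),$$ $$\mathrm{Cov}_n(o,m)\sim -n(2-\sqrt e)\big(\sqrt{e^3}-3e-5\sqrt e+12\big).$$
   Context: Circular table model. There are $n$ places labelled $1,\dots,n$ counter-clockwise around a circular table; place $i-1$ is to the left of place $i$ and place $i+1$ is to its right (indices cyclic). There are $n$ napkins, exactly one between each pair of cyclically consecutive places, so each place has a left napkin and a right napkin (for $n=1$ these are the same single napkin). The guests sit down one at a time in uniformly random order. Independently, each guest prefers the left napkin with probability $p$ and the right napkin with probability $q=1-p$ (here $p=q=1/2$). On sitting down, a guest takes his preferred napkin if it is available; otherwise he takes the other adjacent napkin if that one is available; otherwise he gets no napkin. A guest is napkinless if he gets no napkin, frustrated if he gets a napkin but not the one he prefers, and happy otherwise. The notation $a_n\sim b_n$ means $a_n/b_n\to1$ as $n\to\infty$. *)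

theory Defs
  imports "HOL-Probability.Probability"
begin

text \<open>
  The places are numbered \<open>0, \<dots>, n - 1\<close> counter-clockwise. Napkin \<open>i\<close> lies between place
  \<open>i - 1\<close> and place \<open>i\<close> (cyclically), so it is the left napkin of place \<open>i\<close>. For \<open>n = 1\<close> the left
  and the right napkin coincide.
\<close>

definition left_napkin :: "nat \<Rightarrow> nat \<Rightarrow> nat" where
  "left_napkin n i = i"

definition right_napkin :: "nat \<Rightarrow> nat \<Rightarrow> nat" where
  "right_napkin n i = (i + 1) mod n"

text \<open>\<open>prefers_left i\<close> is the preference of the guest who sits at place \<open>i\<close>.\<close>

definition preferred_napkin :: "nat \<Rightarrow> (nat \<Rightarrow> bool) \<Rightarrow> nat \<Rightarrow> nat" where
  "preferred_napkin n prefers_left i =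
     (if prefers_left i then left_napkin n i else right_napkin n i)"

definition other_napkin :: "nat \<Rightarrow> (nat \<Rightarrow> bool) \<Rightarrow> nat \<Rightarrow> nat" where
  "other_napkin n prefers_left i =
     (if prefers_left i then right_napkin n i else left_napkin n i)"

datatype outcome = Happy | Frustrated | Napkinless

text \<open>
  \<open>seating n prefers_left T xs\<close> lists the outcomes of the guests in the order in which they sit
  down, where \<open>xs\<close> is the list of the places in the order in which they get occupied, and \<open>T\<close> is
  the set of the napkins that have already been taken.
\<close>

fun seating :: "nat \<Rightarrow> (nat \<Rightarrow> bool) \<Rightarrow> nat set \<Rightarrow> nat list \<Rightarrow> outcome list" where
  "seating n prefers_left T [] = []"
| "seating n prefers_left T (i # xs) =
     (if preferred_napkin n prefers_left i \<notin> T
      then Happy # seating n prefers_left (insert (preferred_napkin n prefers_left i) T) xs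
      else if other_napkin n prefers_left i \<notin> T
      then Frustrated # seating n prefers_left (insert (other_napkin n prefers_left i) T) xs
      else Napkinless # seating n prefers_left T xs)"

text \<open>
  The order is uniform among all permutations of the places, and independently of it each guest
  prefers the left napkin with probability \<open>p\<close>, independently of the other guests.
  The value \<open>False\<close> is only the dummy preference outside of \<open>{..<n}\<close>.
\<close>

definition table_pmf :: "real \<Rightarrow> nat \<Rightarrow> (nat list \<times> (nat \<Rightarrow> bool)) pmf" where
  "table_pmf p n =
     pair_pmf (pmf_of_set (permutations_of_set {..<n}))
              (Pi_pmf {..<n} False (\<lambda>_. bernoulli_pmf p))"

definition num_outcome :: "outcome \<Rightarrow> nat \<Rightarrow> nat list \<times> (nat \<Rightarrow> bool) \<Rightarrow> real" where
  "num_outcome c n = (\<lambda>(xs, prefers_left). real (count_list (seating n prefers_left {} xs) c))"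

abbreviation "num_napkinless \<equiv> num_outcome Napkinless"
abbreviation "num_frustrated \<equiv> num_outcome Frustrated"
abbreviation "num_happy \<equiv> num_outcome Happy"

definition covariance_pmf :: "'a pmf \<Rightarrow> ('a \<Rightarrow> real) \<Rightarrow> ('a \<Rightarrow> real) \<Rightarrow> real" where
  "covariance_pmf M X Y =
     measure_pmf.expectation M
       (\<lambda>x. (X x - measure_pmf.expectation M X) * (Y x - measure_pmf.expectation M Y))"

lemma num_happy_eq:
  assumes "\<omega> \<in> set_pmf (table_pmf p n)"
  shows "num_happy n \<omega> = real n - num_napkinless n \<omega> - num_frustrated n \<omega>"
proof -
  obtain xs f where \<omega>: "\<omega> = (xs, f)"
    by (cases \<omega>)
  have "xs \<in> permutations_of_set {..<n}"
    using assms by (auto simp: table_pmf_def \<omega> permutations_of_set_empty_iff)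
  hence len: "length xs = n"
    by (auto dest: length_finite_permutations_of_set)
  have "length xs = count_list (seating n f T xs) Happy +
          (count_list (seating n f T xs) Napkinless + count_list (seating n f T xs) Frustrated)" for T
    by (induction xs arbitrary: T) (simp_all add: add.assoc)
  from this[of "{}"] show ?thesis
    by (simp add: num_outcome_def \<omega> flip: len)
qed

end

theory Submission
  imports Defs
begin

text \<open>
  The guests are weighted by \<open>y\<close> if napkinless and by \<open>z\<close> if frustrated, and the table is split at the
  guest who sits down first. This guest takes a napkin and leaves a row of \<open>n - 1\<close> places with
  \<open>n\<close> napkins in a row, one end napkin being gone. In such a row the first guest again takes at most
  one napkin and leaves two shorter rows, which share no napkin and therefore evolve
  independently (\<open>mean_weight_union\<close>). Hence the mean weight of a row depends only on its length and
  on which of the two end napkins are gone (\<open>mean_weight_table_arc\<close>). Conditioning on the first guest,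
  rather than on the last one, has the advantage that no final states have to be tracked.

  The three generating functions \<open>A\<close>, \<open>B\<close>, \<open>C\<close> of rows, with no, one or two end napkins gone, satisfy
  \<open>A' = A B\<close>, \<open>2 B' = B\<^sup>2 + A C + z B\<close>, \<open>C' = B C + z C + y\<close>, and the mean weight for the circular table with
  \<open>n\<close> guests is the coefficient of \<open>x ^ (n - 1)\<close> in \<open>B = A' / A\<close>. The function \<open>D = 1 / A\<close> satisfies the
  linear equation \<open>2 D''' = 3 z D'' - z\<^sup>2 D' - y\<close> (\<open>free_arc_inverse_ode\<close>), so it is an explicit
  combination of \<open>1\<close>, \<open>x\<close>, \<open>exp (z x / 2)\<close> and \<open>exp (z x)\<close>; this is where the square root of \<open>e\<close> comes from.

  The mean weight is therefore \<open>n\<close> times the coefficient of \<open>x ^ n\<close> in \<open>- log D\<close>, and at \<open>y = z = 1\<close> one has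
  \<open>D = 1 - x\<close>. Putting \<open>y = exp (\<alpha> t)\<close>, \<open>z = exp (\<beta> t)\<close> and differentiating twice at \<open>t = 0\<close> gives exact
  formulas for the first two moments of \<open>\<alpha> o + \<beta> m\<close>, in terms of the two derivatives \<open>D\<^sub>1\<close>, \<open>D\<^sub>2\<close> of \<open>D\<close>, which
  are entire functions of \<open>x\<close>: the moments are the coefficients of \<open>- D\<^sub>1 / (1 - x)\<close> and
  \<open>D\<^sub>1\<^sup>2 / (1 - x)\<^sup>2 - D\<^sub>2 / (1 - x)\<close>, times \<open>n\<close> (\<open>stat_moments_gf\<close>). The poles at 1 determine the asymptotics:
  the mean divided by \<open>n\<close> tends to \<open>- D\<^sub>1 1\<close>, and the variance divided by \<open>n\<close> tends to
  \<open>(D\<^sub>1 1)\<^sup>2 - 2 (D\<^sub>1 1) (D\<^sub>1' 1) - D\<^sub>2 1\<close> (\<open>variance_gf_limit\<close>). Evaluating this for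
  \<open>(\<alpha>, \<beta>) = (1, 0), (0, 1), (1, 1)\<close> gives all the constants, since \<open>h = n - o - m\<close> and
  \<open>2 Cov (o, m) = Var (o + m) - Var o - Var m\<close>.
\<close>

section \<open>Independence of separated parts of the table\<close>

lemma expectation_pair_pmf_finite:
  fixes h :: "'a \<times> 'b \<Rightarrow> real"
  assumes "finite (set_pmf p)" "finite (set_pmf q)"
  shows "measure_pmf.expectation (pair_pmf p q) h =
         measure_pmf.expectation p (\<lambda>a. measure_pmf.expectation q (\<lambda>b. h (a, b)))"
proof -
  have "measure_pmf.expectation (pair_pmf p q) h =
        (\<Sum>a\<in>set_pmf p. pmf p a *\<^sub>R measure_pmf.expectation (map_pmf (Pair a) q) h)"
    unfolding pair_pmf_def map_pmf_def[symmetric]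
    using assms by (subst pmf_expectation_bind[of "set_pmf p"]) auto
  also have "\<dots> = measure_pmf.expectation p (\<lambda>a. measure_pmf.expectation q (\<lambda>b. h (a, b)))"
    using assms by (subst integral_measure_pmf[of "set_pmf p"]) auto
  finally show ?thesis .
qed

text \<open>
  Weighting every napkinless guest by \<open>y\<close> and every frustrated guest by \<open>z\<close> makes the mean weight
  of a seating the joint probability generating function of \<open>o\<close> and \<open>m\<close>. A product weight is what
  turns the independence of separated parts of the table into a factorization.
\<close>

definition outcome_weight :: "real \<Rightarrow> real \<Rightarrow> outcome \<Rightarrow> real" where
  "outcome_weight y z c = (case c of Happy \<Rightarrow> 1 | Frustrated \<Rightarrow> z | Napkinless \<Rightarrow> y)"

definition seating_weight ::
    "real \<Rightarrow> real \<Rightarrow> nat \<Rightarrow> (nat \<Rightarrow> bool) \<Rightarrow> nat set \<Rightarrow> nat list \<Rightarrow> real" where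
  "seating_weight y z n f T xs = prod_list (map (outcome_weight y z) (seating n f T xs))"

lemma seating_weight_Nil [simp]: "seating_weight y z n f T [] = 1"
  by (simp add: seating_weight_def)

lemma seating_weight_Cons:
  "seating_weight y z n f T (i # xs) =
     (if preferred_napkin n f i \<notin> T
      then seating_weight y z n f (insert (preferred_napkin n f i) T) xs
      else if other_napkin n f i \<notin> T
      then z * seating_weight y z n f (insert (other_napkin n f i) T) xs
      else y * seating_weight y z n f T xs)"
  by (simp add: seating_weight_def outcome_weight_def)

definition napkins :: "nat \<Rightarrow> nat set \<Rightarrow> nat set" where
  "napkins n A = left_napkin n ` A \<union> right_napkin n ` A"

lemma preferred_napkin_in: "i \<in> A \<Longrightarrow> preferred_napkin n f i \<in> napkins n A"
  and other_napkin_in: "i \<in> A \<Longrightarrow> other_napkin n f i \<in> napkins n A"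
  by (auto simp: napkins_def preferred_napkin_def other_napkin_def)

text \<open>
  Guests see only the napkins next to them and the preferences of those who sit down. This locality
  is the source of all independence below.
\<close>

lemma seating_cong:
  assumes "set xs \<subseteq> A" "\<And>i. i \<in> set xs \<Longrightarrow> f i = g i" "T \<inter> napkins n A = T' \<inter> napkins n A"
  shows "seating n f T xs = seating n g T' xs"
  using assms
proof (induction xs arbitrary: T T')
  case Nil
  show ?case by simp
next
  case (Cons i xs)
  have eq: "preferred_napkin n f i = preferred_napkin n g i" "other_napkin n f i = other_napkin n g i"
    using Cons.prems by (simp_all add: preferred_napkin_def other_napkin_def)
  have mem: "t \<in> T \<longleftrightarrow> t \<in> T'" if "t \<in> napkins n A" for t
    using Cons.prems(3) that by blast
  have m1: "preferred_napkin n g i \<in> T \<longleftrightarrow> preferred_napkin n g i \<in> T'"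
    and m2: "other_napkin n g i \<in> T \<longleftrightarrow> other_napkin n g i \<in> T'"
    using Cons.prems(1) by (auto intro!: mem preferred_napkin_in other_napkin_in)
  have IH: "seating n f U xs = seating n g U' xs" if "U \<inter> napkins n A = U' \<inter> napkins n A" for U U'
    using Cons.prems that by (intro Cons.IH) auto
  have ins: "seating n f (insert t T) xs = seating n g (insert t T') xs" for t
    using Cons.prems(3) by (intro IH) blast
  show ?case
    using Cons.prems(3) by (simp add: eq m1 m2 ins IH)
qed

lemma seating_weight_cong:
  assumes "set xs \<subseteq> A" "\<And>i. i \<in> set xs \<Longrightarrow> f i = g i" "T \<inter> napkins n A = T' \<inter> napkins n A"
  shows "seating_weight y z n f T xs = seating_weight y z n g T' xs"
  unfolding seating_weight_def by (simp add: seating_cong[OF assms])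

text \<open>
  Two groups without a common napkin never interact, however their arrivals are interleaved: the
  napkin that is taken by a member of one group is invisible to the other group.
\<close>

lemma seating_weight_split:
  assumes "set xs \<subseteq> A \<union> B" "A \<inter> B = {}" "napkins n A \<inter> napkins n B = {}"
  shows "seating_weight y z n f T xs =
           seating_weight y z n f T (filter (\<lambda>i. i \<in> A) xs) *
           seating_weight y z n f T (filter (\<lambda>i. i \<notin> A) xs)"
  using assms(1)
proof (induction xs arbitrary: T)
  case Nil
  show ?case by simp
next
  case (Cons i xs)
  have IH: "seating_weight y z n f U xs =
           seating_weight y z n f U (filter (\<lambda>i. i \<in> A) xs) *
           seating_weight y z n f U (filter (\<lambda>i. i \<notin> A) xs)" for U
    using Cons.prems by (intro Cons.IH) auto
  have out: "seating_weight y z n f (insert t T) ys = seating_weight y z n f T ys"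
    if "set ys \<subseteq> C" "t \<notin> napkins n C" for t ys C
    using that by (intro seating_weight_cong[of _ C]) auto
  show ?case
  proof (cases "i \<in> A")
    case True
    have "t \<notin> napkins n B" if "t = preferred_napkin n f i \<or> t = other_napkin n f i" for t
      using that assms(3) preferred_napkin_in[OF True] other_napkin_in[OF True] by blast
    hence "seating_weight y z n f (insert t T) (filter (\<lambda>i. i \<notin> A) xs) =
           seating_weight y z n f T (filter (\<lambda>i. i \<notin> A) xs)"
      if "t = preferred_napkin n f i \<or> t = other_napkin n f i" for t
      using that Cons.prems by (intro out[of _ B]) auto
    with True show ?thesis
      by (simp add: seating_weight_Cons IH)
  next
    case False
    hence B: "i \<in> B" using Cons.prems by auto
    have "t \<notin> napkins n A" if "t = preferred_napkin n f i \<or> t = other_napkin n f i" for t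
      using that assms(3) preferred_napkin_in[OF B] other_napkin_in[OF B] by blast
    hence "seating_weight y z n f (insert t T) (filter (\<lambda>i. i \<in> A) xs) =
           seating_weight y z n f T (filter (\<lambda>i. i \<in> A) xs)"
      if "t = preferred_napkin n f i \<or> t = other_napkin n f i" for t
      using that by (intro out[of _ A]) auto
    with False show ?thesis
      by (simp add: seating_weight_Cons IH)
  qed
qed

abbreviation coins :: "nat set \<Rightarrow> (nat \<Rightarrow> bool) pmf" where
  "coins A \<equiv> Pi_pmf A False (\<lambda>_. bernoulli_pmf (1/2))"

abbreviation orders :: "nat set \<Rightarrow> nat list pmf" where
  "orders A \<equiv> pmf_of_set (permutations_of_set A)"

text \<open>
  Here \<open>A\<close> is the set of the places that are still empty and \<open>T\<close> the set of the napkins that are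
  gone. A process that is stopped at any time continues as a process of this form.
\<close>

definition mean_weight :: "real \<Rightarrow> real \<Rightarrow> nat \<Rightarrow> nat set \<Rightarrow> nat set \<Rightarrow> real" where
  "mean_weight y z n T A =
     measure_pmf.expectation (pair_pmf (orders A) (coins A))
       (\<lambda>(xs, f). seating_weight y z n f T xs)"

lemma set_orders: "finite A \<Longrightarrow> set_pmf (orders A) = permutations_of_set A"
  by (intro set_pmf_of_set) (auto simp: permutations_of_set_empty_iff)

lemma finite_orders [simp]: "finite A \<Longrightarrow> finite (set_pmf (orders A))"
  by (simp add: set_orders)

lemma finite_coins [simp]: "finite A \<Longrightarrow> finite (set_pmf (coins A))"
  by (auto simp: set_Pi_pmf intro!: finite_PiE_dflt)

lemma mean_weight_iterated:
  assumes "finite A"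
  shows "mean_weight y z n T A =
     measure_pmf.expectation (orders A)
       (\<lambda>xs. measure_pmf.expectation (coins A) (\<lambda>f. seating_weight y z n f T xs))"
  unfolding mean_weight_def using assms by (subst expectation_pair_pmf_finite) auto

lemma mean_weight_empty [simp]: "mean_weight y z n T {} = 1"
  by (simp add: mean_weight_iterated pmf_of_set_singleton)

lemma mean_weight_cong:
  assumes "finite A" "T \<inter> napkins n A = T' \<inter> napkins n A"
  shows "mean_weight y z n T A = mean_weight y z n T' A"
  unfolding mean_weight_iterated[OF assms(1)]
  using assms
  by (intro integral_cong_AE AE_pmfI)
     (auto simp: set_orders permutations_of_setD
           intro!: Bochner_Integration.integral_cong seating_weight_cong[of _ A])

text \<open>
  The restrictions of a uniform order of \<open>A \<union> B\<close> to \<open>A\<close> and to \<open>B\<close> are independent and uniform,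
  and so are the preferences. The weight depends only on these restrictions.
\<close>

lemma mean_weight_union:
  assumes fin: "finite A" "finite B" and disj: "A \<inter> B = {}" "napkins n A \<inter> napkins n B = {}"
  shows "mean_weight y z n T (A \<union> B) = mean_weight y z n T A * mean_weight y z n T B"
proof -
  let ?w = "\<lambda>f xs. seating_weight y z n f T xs"
  let ?E = measure_pmf.expectation
  define \<phi> where "\<phi> = (\<lambda>A xs. ?E (coins A) (\<lambda>f. ?w f xs))"
  have coins_split: "?E (coins (A \<union> B)) (\<lambda>f. ?w f xs) =
      \<phi> A (filter (\<lambda>i. i \<in> A) xs) * \<phi> B (filter (\<lambda>i. i \<notin> A) xs)"
    if xs: "xs \<in> permutations_of_set (A \<union> B)" for xs
  proof -
    have sub: "set xs = A \<union> B"
      using xs by (auto simp: permutations_of_set_def)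
    have "?E (coins (A \<union> B)) (\<lambda>f. ?w f xs) =
          ?E (coins A) (\<lambda>f. ?E (coins B) (\<lambda>g. ?w (\<lambda>x. if x \<in> A then f x else g x) xs))"
      using fin disj by (simp add: Pi_pmf_union expectation_pair_pmf_finite case_prod_beta)
    also have "\<dots> = ?E (coins A) (\<lambda>f. ?E (coins B) (\<lambda>g. 
          ?w f (filter (\<lambda>i. i \<in> A) xs) * ?w g (filter (\<lambda>i. i \<notin> A) xs)))"
    proof (intro Bochner_Integration.integral_cong refl)
      fix f g
      show "?w (\<lambda>x. if x \<in> A then f x else g x) xs =
              ?w f (filter (\<lambda>i. i \<in> A) xs) * ?w g (filter (\<lambda>i. i \<notin> A) xs)"
        using sub disj
        by (subst seating_weight_split[of xs A B])
           (auto intro!: arg_cong2[of _ _ _ _ "(*)"] seating_weight_cong[of _ UNIV])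
    qed
    also have "\<dots> = \<phi> A (filter (\<lambda>i. i \<in> A) xs) * \<phi> B (filter (\<lambda>i. i \<notin> A) xs)"
      by (simp add: \<phi>_def)
    finally show ?thesis .
  qed
  have AB: "{x \<in> A \<union> B. x \<in> A} = A" "{x \<in> A \<union> B. x \<notin> A} = B"
    using disj by auto
  have "mean_weight y z n T (A \<union> B) =
          ?E (orders (A \<union> B)) (\<lambda>xs. case partition (\<lambda>i. i \<in> A) xs of (us, vs) \<Rightarrow> \<phi> A us * \<phi> B vs)"
    unfolding mean_weight_iterated[OF finite_UnI[OF fin]]
    by (intro integral_cong_AE AE_pmfI)
       (auto simp: set_orders fin coins_split o_def)
  also have "\<dots> = ?E (map_pmf (partition (\<lambda>i. i \<in> A)) (orders (A \<union> B))) (\<lambda>(us, vs). \<phi> A us * \<phi> B vs)"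
    by simp
  also have "\<dots> = ?E (pair_pmf (orders A) (orders B)) (\<lambda>(us, vs). \<phi> A us * \<phi> B vs)"
    using fin by (subst partition_random_permutations) (simp_all only: AB finite_UnI)
  also have "\<dots> = ?E (orders A) (\<phi> A) * ?E (orders B) (\<phi> B)"
    using fin by (simp add: expectation_pair_pmf_finite)
  also have "\<dots> = mean_weight y z n T A * mean_weight y z n T B"
    using fin by (simp add: mean_weight_iterated \<phi>_def)
  finally show ?thesis .
qed

text \<open>
  The first guest occupies a uniformly chosen place, the order of the others remains uniform, and the
  coin of the first guest is independent of the coins of the others.
\<close>

lemma mean_weight_first:
  assumes fin: "finite A" and ne: "A \<noteq> {}"
  shows "mean_weight y z n T A =
    (\<Sum>i\<in>A.
      (if left_napkin n i \<notin> T then mean_weight y z n (insert (left_napkin n i) T) (A - {i})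
       else if right_napkin n i \<notin> T
       then z * mean_weight y z n (insert (right_napkin n i) T) (A - {i})
       else y * mean_weight y z n T (A - {i})) / 2 +
      (if right_napkin n i \<notin> T then mean_weight y z n (insert (right_napkin n i) T) (A - {i})
       else if left_napkin n i \<notin> T
       then z * mean_weight y z n (insert (left_napkin n i) T) (A - {i})
       else y * mean_weight y z n T (A - {i})) / 2) / card A"
proof -
  let ?E = measure_pmf.expectation
  let ?w = "\<lambda>f xs. seating_weight y z n f T xs"
  have step: "?E (orders (A - {i})) (\<lambda>xs. ?E (coins A) (\<lambda>f. ?w f (i # xs))) =
      (if left_napkin n i \<notin> T then mean_weight y z n (insert (left_napkin n i) T) (A - {i})
       else if right_napkin n i \<notin> T
       then z * mean_weight y z n (insert (right_napkin n i) T) (A - {i})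
       else y * mean_weight y z n T (A - {i})) / 2 +
      (if right_napkin n i \<notin> T then mean_weight y z n (insert (right_napkin n i) T) (A - {i})
       else if left_napkin n i \<notin> T
       then z * mean_weight y z n (insert (left_napkin n i) T) (A - {i})
       else y * mean_weight y z n T (A - {i})) / 2" if i: "i \<in> A" for i
  proof -
    have A: "A = insert i (A - {i})" using i by auto
    have "?E (coins A) (\<lambda>f. ?w f (i # xs)) =
      (if left_napkin n i \<notin> T
       then ?E (coins (A - {i})) (\<lambda>f. seating_weight y z n f (insert (left_napkin n i) T) xs)
       else if right_napkin n i \<notin> T
       then z * ?E (coins (A - {i})) (\<lambda>f. seating_weight y z n f (insert (right_napkin n i) T) xs)
       else y * ?E (coins (A - {i})) (\<lambda>f. seating_weight y z n f T xs)) / 2 +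
      (if right_napkin n i \<notin> T
       then ?E (coins (A - {i})) (\<lambda>f. seating_weight y z n f (insert (right_napkin n i) T) xs)
       else if left_napkin n i \<notin> T
       then z * ?E (coins (A - {i})) (\<lambda>f. seating_weight y z n f (insert (left_napkin n i) T) xs)
       else y * ?E (coins (A - {i})) (\<lambda>f. seating_weight y z n f T xs)) / 2"
      if xs: "xs \<in> permutations_of_set (A - {i})" for xs
    proof -
      have set_xs: "set xs = A - {i}" using xs by (auto simp: permutations_of_set_def)
      have upd: "seating_weight y z n (f(i := b)) U xs = seating_weight y z n f U xs" for f b U
        using set_xs by (intro seating_weight_cong[of _ UNIV]) auto
      have "?E (coins A) (\<lambda>f. ?w f (i # xs)) =
          ?E (pair_pmf (bernoulli_pmf (1/2)) (coins (A - {i}))) (\<lambda>(b, f). ?w (f(i := b)) (i # xs))"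
        using fin by (subst A, subst Pi_pmf_insert) (simp_all add: case_prod_unfold)
      also have "\<dots> = ?E (bernoulli_pmf (1/2)) (\<lambda>b. ?E (coins (A - {i})) (\<lambda>f. ?w (f(i := b)) (i # xs)))"
        using fin by (subst expectation_pair_pmf_finite) auto
      also have "\<dots> = ?E (coins (A - {i})) (\<lambda>f. ?w (f(i := True)) (i # xs)) / 2 +
                      ?E (coins (A - {i})) (\<lambda>f. ?w (f(i := False)) (i # xs)) / 2"
        by simp
      finally show ?thesis
        by (simp add: seating_weight_Cons upd preferred_napkin_def other_napkin_def)
    qed
    note coin = this
    have int: "integrable (measure_pmf (orders (A - {i}))) h" for h :: "nat list \<Rightarrow> real"
      using fin by (intro integrable_measure_pmf_finite) auto
    show ?thesis
      unfolding mean_weight_iterated[OF finite_Diff[OF fin]]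
      by (subst integral_cong_AE[OF _ _ AE_pmfI[OF coin]])
         (auto simp: set_orders fin int)
  qed
  have "mean_weight y z n T A = (\<Sum>i\<in>A. ?E (orders (A - {i})) (\<lambda>xs. ?E (coins A) (\<lambda>f. ?w f (i # xs)))) / card A"
    unfolding mean_weight_iterated[OF fin] random_permutation_of_set[OF fin ne]
    using fin ne
    by (subst pmf_expectation_bind_pmf_of_set)
       (auto simp: map_pmf_def[symmetric] sum_divide_distrib scaleR_conv_of_real divide_simps)
  thus ?thesis by (simp add: step)
qed

section \<open>Rows of empty places\<close>

text \<open>
  \<open>arc_value y z l a b\<close> is the mean weight of a row of \<open>l\<close> empty places whose \<open>l - 1\<close> interior napkins
  are available, where \<open>a\<close> and \<open>b\<close> say whether the leftmost and the rightmost napkin are gone. The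
  first guest of the row, at distance \<open>i\<close> from its left end, separates it into two such rows.

  In a row without places both ends are the same napkin, so \<open>a\<close> and \<open>b\<close> would have to agree. The
  values at \<open>l = 0\<close> are a convention that avoids exceptions in the recursion: the pair \<open>True, True\<close>
  arises exactly in the summands in which the first guest would take an end napkin that is already
  gone, so its value 0 removes them, and in all other cases an empty row contributes the factor 1.
  The summands with \<open>z\<close> and \<open>y\<close> account for a first guest at an end of the row whose preferred napkin
  is gone.
\<close>

fun arc_value :: "real \<Rightarrow> real \<Rightarrow> nat \<Rightarrow> bool \<Rightarrow> bool \<Rightarrow> real" where
  "arc_value y z 0 a b = (if a \<and> b then 0 else 1)"
| "arc_value y z (Suc l) a b =
     ((\<Sum>i\<le>l. (arc_value y z i a True * arc_value y z (l - i) False b +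
               arc_value y z i a False * arc_value y z (l - i) True b) / 2) +
      (if a then z * arc_value y z l True b / 2 else 0) +
      (if b then z * arc_value y z l a True / 2 else 0) +
      (if a \<and> b \<and> l = 0 then y else 0)) / real (Suc l)"

lemma arc_value_commute: "arc_value y z l a b = arc_value y z l b a"
proof (induction l arbitrary: a b rule: less_induct)
  case (less l)
  show ?case
  proof (cases l)
    case (Suc m)
    have IH: "arc_value y z i c d = arc_value y z i d c" if "i \<le> m" for i c d
      using less Suc that by simp
    have "(\<Sum>i\<le>m. (arc_value y z i a True * arc_value y z (m - i) False b +
               arc_value y z i a False * arc_value y z (m - i) True b) / 2) =
          (\<Sum>i\<le>m. (arc_value y z (m - i) a True * arc_value y z i False b +
               arc_value y z (m - i) a False * arc_value y z i True b) / 2)"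
      by (subst sum.nat_diff_reindex[symmetric, of _ "Suc m", unfolded lessThan_Suc_atMost])
         (auto intro!: sum.cong)
    also have "\<dots> = (\<Sum>i\<le>m. (arc_value y z i b True * arc_value y z (m - i) False a +
               arc_value y z i b False * arc_value y z (m - i) True a) / 2)"
    proof (intro sum.cong refl)
      fix i assume "i \<in> {..m}"
      hence "arc_value y z (m - i) a True = arc_value y z (m - i) True a"
        "arc_value y z (m - i) a False = arc_value y z (m - i) False a"
        "arc_value y z i False b = arc_value y z i b False"
        "arc_value y z i True b = arc_value y z i b True"
        by (auto intro!: IH)
      thus "(arc_value y z (m - i) a True * arc_value y z i False b +
               arc_value y z (m - i) a False * arc_value y z i True b) / 2 =
            (arc_value y z i b True * arc_value y z (m - i) False a +
               arc_value y z i b False * arc_value y z (m - i) True a) / 2"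
        by (simp only:) (simp only: mult.commute add.commute)
    qed
    finally have eq: "(\<Sum>i\<le>m. (arc_value y z i a True * arc_value y z (m - i) False b +
               arc_value y z i a False * arc_value y z (m - i) True b) / 2) = \<dots>" .
    have eqs: "arc_value y z m a True = arc_value y z m True a"
      "arc_value y z m b True = arc_value y z m True b"
      by (rule IH; simp)+
    show ?thesis
      unfolding Suc arc_value.simps(2) eq eqs by (simp only: ac_simps conj_ac)
  qed auto
qed

text \<open>
  The row of \<open>l\<close> consecutive places that starts at place \<open>s\<close>, reduced modulo \<open>n\<close>: rows may wrap
  around the numbering of the table.
\<close>

definition table_arc :: "nat \<Rightarrow> nat \<Rightarrow> nat \<Rightarrow> nat set" where
  "table_arc n s l = (\<lambda>i. (s + i) mod n) ` {..<l}"

lemma finite_table_arc [simp]: "finite (table_arc n s l)"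
  by (simp add: table_arc_def)

lemma table_arc_0 [simp]: "table_arc n s 0 = {}"
  by (simp add: table_arc_def)

lemma mod_shift_eq_iff:
  assumes "i < n" "j < n"
  shows "(s + i) mod n = (s + j) mod n \<longleftrightarrow> i = (j :: nat)"
proof
  have le: "i = j" if "i \<le> j" "i < n" "j < n" "(s + i) mod n = (s + j) mod n" for i j
  proof -
    have "n dvd j - i"
      using mod_eq_dvd_iff_nat[of "s + i" "s + j" n] that(1) that(4)[symmetric] by simp
    moreover have "j - i < n" using that(3) by simp
    ultimately have "j - i = 0"
      using nat_dvd_not_less by blast
    thus "i = j" using that(1) by simp
  qed
  assume "(s + i) mod n = (s + j) mod n"
  thus "i = j"
    using le[of i j] le[of j i] assms by (metis nat_le_linear)
qed simp

lemma napkins_table_arc: "napkins n (table_arc n s l) \<subseteq> (\<lambda>i. (s + i) mod n) ` {..l}"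
proof -
  have "left_napkin n ((s + i) mod n) = (s + i) mod n"
    "right_napkin n ((s + i) mod n) = (s + Suc i) mod n" for i
    by (simp_all add: left_napkin_def right_napkin_def mod_Suc_eq)
  hence "left_napkin n ` table_arc n s l = (\<lambda>i. (s + i) mod n) ` {..<l}"
    "right_napkin n ` table_arc n s l = (\<lambda>i. (s + i) mod n) ` Suc ` {..<l}"
    unfolding table_arc_def image_image by (simp_all only:)
  thus ?thesis
    unfolding napkins_def by auto
qed

lemma table_arc_remove:
  assumes "i < l" "l \<le> n"
  shows "table_arc n s l - {(s + i) mod n} = table_arc n s i \<union> table_arc n (Suc (s + i)) (l - Suc i)"
proof -
  have inj: "inj_on (\<lambda>i. (s + i) mod n) {..<l}"
    using assms by (auto simp: inj_on_def mod_shift_eq_iff)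
  have "table_arc n s l - {(s + i) mod n} = (\<lambda>i. (s + i) mod n) ` ({..<l} - {i})"
    unfolding table_arc_def using assms by (subst inj_on_image_set_diff[OF inj]) auto
  also have "{..<l} - {i} = {..<i} \<union> (\<lambda>j. i + 1 + j) ` {..<l - Suc i}"
  proof (intro equalityI subsetI)
    fix x assume "x \<in> {..<l} - {i}"
    hence "x < i \<or> (x = i + 1 + (x - Suc i) \<and> x - Suc i < l - Suc i)"
      by auto
    thus "x \<in> {..<i} \<union> (\<lambda>j. i + 1 + j) ` {..<l - Suc i}"
      by blast
  qed (use assms in auto)
  finally show ?thesis
    by (simp add: table_arc_def image_Un image_image add_ac)
qed

text \<open>
  The hypothesis \<open>l < n\<close> guarantees that the \<open>l + 1\<close> napkins of the row are distinct, so that the two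
  rows that the first guest leaves behind have no napkin in common and
  the factorization applies to them.
\<close>

theorem mean_weight_table_arc:
  assumes "l < n" "l > 0" "\<And>i. 0 < i \<Longrightarrow> i < l \<Longrightarrow> (s + i) mod n \<notin> T"
  shows "mean_weight y z n T (table_arc n s l) = arc_value y z l (s mod n \<in> T) ((s + l) mod n \<in> T)"
  using assms
proof (induction l arbitrary: s T rule: less_induct)
  case (less l)
  then obtain m where l: "l = Suc m" by (cases l) auto
  define pl where "pl = (\<lambda>i. (s + i) mod n)"
  have pl_eq: "pl i = pl j \<longleftrightarrow> i = j" if "i \<le> l" "j \<le> l" for i j
    using that less.prems unfolding pl_def by (intro mod_shift_eq_iff) auto
  define a b where "a \<longleftrightarrow> pl 0 \<in> T" and "b \<longleftrightarrow> pl l \<in> T"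
  let ?W = "arc_value y z"
  have free: "pl i \<notin> T" if "0 < i" "i < l" for i
    using less.prems that by (auto simp: pl_def)
  have inT: "pl i \<in> T \<longleftrightarrow> i = 0 \<and> a" "pl (Suc i) \<in> T \<longleftrightarrow> i = m \<and> b" if "i \<le> m" for i
    using that free[of i] free[of "Suc i"] by (cases "i = 0"; cases "i = m"; auto simp: a_def b_def l)+

  \<comment> \<open>The induction hypothesis for the two rows left behind; a row without places has mean weight 1, whatever \<open>U\<close>.\<close>
  have left: "mean_weight y z n U (table_arc n s i) = (if i = 0 then 1 else ?W i (pl 0 \<in> U) (pl i \<in> U))"
    if "i \<le> m" "\<And>j. 0 < j \<Longrightarrow> j < i \<Longrightarrow> pl j \<notin> U" for i U
    using that less.prems less.IH[of i s U] by (auto simp: l pl_def)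
  have right: "mean_weight y z n U (table_arc n (Suc (s + i)) (m - i)) =
      (if i = m then 1 else ?W (m - i) (pl (Suc i) \<in> U) (pl l \<in> U))"
    if "i \<le> m" "\<And>j. Suc i < j \<Longrightarrow> j < l \<Longrightarrow> pl j \<notin> U" for i U
  proof (cases "i = m")
    case False
    have "(Suc (s + i) + j) mod n \<notin> U" if "0 < j" "j < m - i" for j
      using that \<open>\<And>j. Suc i < j \<Longrightarrow> j < l \<Longrightarrow> pl j \<notin> U\<close>[of "Suc i + j"]
      by (simp add: pl_def l add_ac)
    with False show ?thesis
      using that(1) less.prems less.IH[of "m - i" "Suc (s + i)" U] by (simp add: l pl_def)
  qed auto
  have split: "mean_weight y z n U (table_arc n s l - {pl i}) =
      mean_weight y z n U (table_arc n s i) * mean_weight y z n U (table_arc n (Suc (s + i)) (m - i))"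
    if i: "i \<le> m" for i U
  proof -
    have disj: "pl ` {..i} \<inter> (\<lambda>j. pl (Suc i + j)) ` {..m - i} = {}"
    proof -
      have "pl j \<noteq> pl (Suc i + k)" if "j \<le> i" "k \<le> m - i" for j k
        using that i by (subst pl_eq) (auto simp: l)
      thus ?thesis by blast
    qed
    have sub1: "napkins n (table_arc n s i) \<subseteq> pl ` {..i}"
      unfolding pl_def by (rule napkins_table_arc)
    have sub2: "napkins n (table_arc n (Suc (s + i)) (m - i)) \<subseteq> (\<lambda>j. pl (Suc i + j)) ` {..m - i}"
      using napkins_table_arc[of n "Suc (s + i)" "m - i"] by (simp add: pl_def add_ac)
    have places: "table_arc n s' k \<subseteq> napkins n (table_arc n s' k)" for s' k
      by (auto simp: napkins_def left_napkin_def)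
    have "table_arc n s l - {pl i} = table_arc n s i \<union> table_arc n (Suc (s + i)) (m - i)"
      using table_arc_remove[of i l n s] i less.prems by (simp add: l pl_def)
    moreover have "napkins n (table_arc n s i) \<inter> napkins n (table_arc n (Suc (s + i)) (m - i)) = {}"
      using disj sub1 sub2 by blast
    moreover from this have "table_arc n s i \<inter> table_arc n (Suc (s + i)) (m - i) = {}"
      using places[of s i] places[of "Suc (s + i)" "m - i"] by blast
    ultimately show ?thesis
      using mean_weight_union[OF finite_table_arc finite_table_arc] by metis
  qed

  have ins: "mean_weight y z n (insert (pl i) T) (table_arc n s l - {pl i}) = ?W i a True * ?W (m - i) False b"
    if i: "i \<le> m" "\<not> (i = 0 \<and> a)" for i
  proof -
    have ne: "pl j \<noteq> pl i" if "j \<noteq> i" "j \<le> l" for j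
      using that i by (subst pl_eq) (auto simp: l)
    have mem: "pl 0 \<in> insert (pl i) T \<longleftrightarrow> i = 0 \<or> a" "pl l \<in> insert (pl i) T \<longleftrightarrow> b"
      "pl (Suc i) \<in> insert (pl i) T \<longleftrightarrow> i = m \<and> b"
      using ne[of 0] ne[of l] ne[of "Suc i"] i inT(2)[of i] by (auto simp: a_def b_def l)
    have L: "mean_weight y z n (insert (pl i) T) (table_arc n s i) = ?W i a True"
      using left[of i "insert (pl i) T"] i free ne mem by (cases "i = 0") (simp_all add: l)
    have R: "mean_weight y z n (insert (pl i) T) (table_arc n (Suc (s + i)) (m - i)) = ?W (m - i) False b"
      using right[of i "insert (pl i) T"] i free ne mem by (cases "i = m") simp_all
    show ?thesis using i by (simp only: split L R)
  qed
  have ins': "mean_weight y z n (insert (pl (Suc i)) T) (table_arc n s l - {pl i}) =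
                ?W i a False * ?W (m - i) True b"
    if i: "i \<le> m" "\<not> (i = m \<and> b)" for i
  proof -
    have ne: "pl j \<noteq> pl (Suc i)" if "j \<noteq> Suc i" "j \<le> l" for j
      using that i by (subst pl_eq) (auto simp: l)
    have mem: "pl 0 \<in> insert (pl (Suc i)) T \<longleftrightarrow> a" "pl l \<in> insert (pl (Suc i)) T \<longleftrightarrow> i = m \<or> b"
      "pl i \<in> insert (pl (Suc i)) T \<longleftrightarrow> i = 0 \<and> a"
      using ne[of 0] ne[of l] ne[of i] i inT(1)[of i] by (cases "i = m"; simp add: a_def b_def l)+
    have L: "mean_weight y z n (insert (pl (Suc i)) T) (table_arc n s i) = ?W i a False"
      using left[of i "insert (pl (Suc i)) T"] i free ne mem by (cases "i = 0") (simp_all add: l)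
    have R: "mean_weight y z n (insert (pl (Suc i)) T) (table_arc n (Suc (s + i)) (m - i)) = ?W (m - i) True b"
      using right[of i "insert (pl (Suc i)) T"] i free ne mem by (cases "i = m") simp_all
    show ?thesis using i by (simp only: split L R)
  qed

  have napkin: "left_napkin n (pl i) = pl i" "right_napkin n (pl i) = pl (Suc i)" for i
    by (simp_all add: left_napkin_def right_napkin_def pl_def mod_Suc_eq)
  have inj: "inj_on pl {..m}"
    using pl_eq by (auto simp: inj_on_def l)
  have arc: "table_arc n s l = pl ` {..m}"
    by (simp add: table_arc_def pl_def l lessThan_Suc_atMost)
  have card: "card (table_arc n s l) = Suc m"
    unfolding arc by (simp add: card_image[OF inj])
  have term1: "(if pl i \<notin> T then mean_weight y z n (insert (pl i) T) (table_arc n s l - {pl i})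
       else if pl (Suc i) \<notin> T then z * mean_weight y z n (insert (pl (Suc i)) T) (table_arc n s l - {pl i})
       else y * mean_weight y z n T (table_arc n s l - {pl i})) =
      ?W i a True * ?W (m - i) False b +
      (if i = 0 then if a then z * ?W m True b + (if m = 0 \<and> b then y else 0) else 0 else 0)"
    if i: "i \<le> m" for i
    using i inT[OF i] ins[OF i] ins'[OF i] split[of 0]
    by (cases "i = 0"; cases a; cases b; cases "m = 0") auto
  have term2: "(if pl (Suc i) \<notin> T then mean_weight y z n (insert (pl (Suc i)) T) (table_arc n s l - {pl i})
       else if pl i \<notin> T then z * mean_weight y z n (insert (pl i) T) (table_arc n s l - {pl i})
       else y * mean_weight y z n T (table_arc n s l - {pl i})) =
      ?W i a False * ?W (m - i) True b +
      (if i = m then if b then z * ?W m a True + (if m = 0 \<and> a then y else 0) else 0 else 0)"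
    if i: "i \<le> m" for i
    using i inT[OF i] ins[OF i] ins'[OF i] split[of 0]
    by (cases "i = m"; cases a; cases b; cases "m = 0") auto
  have "mean_weight y z n T (table_arc n s l) =
     (\<Sum>i\<le>m. (?W i a True * ?W (m - i) False b +
       (if i = 0 then if a then z * ?W m True b + (if m = 0 \<and> b then y else 0) else 0 else 0)) / 2 +
      (?W i a False * ?W (m - i) True b +
       (if i = m then if b then z * ?W m a True + (if m = 0 \<and> a then y else 0) else 0 else 0)) / 2) / Suc m"
  proof -
    have "table_arc n s l \<noteq> {}" by (simp add: arc)
    show ?thesis
      unfolding mean_weight_first[OF finite_table_arc \<open>table_arc n s l \<noteq> {}\<close>] card
      unfolding arc sum.reindex[OF inj] o_def napkin
      by (intro arg_cong2[of _ _ _ _ "(/)"] sum.cong refl)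
         (simp only: atMost_iff term1[unfolded arc] term2[unfolded arc])
  qed
  also have "\<dots> = ?W l a b"
    unfolding l arc_value.simps
    by (simp add: add_divide_distrib sum.distrib sum.delta flip: sum_divide_distrib) 
  finally show ?case
    by (simp add: a_def b_def pl_def)
qed

text \<open>
  The first guest gets the preferred napkin and leaves a row of \<open>n - 1\<close> places in which exactly one of
  the two end napkins is gone. For \<open>n = 1\<close> the only guest is happy, in agreement with the value of
  \<open>arc_value\<close> at length 0.
\<close>

theorem mean_weight_circle:
  assumes "n > 0"
  shows "mean_weight y z n {} {..<n} = arc_value y z (n - 1) False True"
proof (cases "n = 1")
  case True
  show ?thesis
    using assms by (subst mean_weight_first) (auto simp: True lessThan_Suc)
next
  case False
  hence n: "n \<ge> 2" using assms by simp
  have step: "mean_weight y z n {i} ({..<n} - {i}) = arc_value y z (n - 1) False True"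
    "mean_weight y z n {Suc i mod n} ({..<n} - {i}) = arc_value y z (n - 1) False True"
    if i: "i < n" for i
  proof -
    have circle: "{..<n} = table_arc n i n"
    proof -
      have "table_arc n i n \<subseteq> {..<n}" using n by (auto simp: table_arc_def)
      moreover have "card (table_arc n i n) = n"
        unfolding table_arc_def by (subst card_image) (auto simp: inj_on_def mod_shift_eq_iff)
      ultimately show ?thesis
        by (intro card_subset_eq[symmetric]) auto
    qed
    have arc_rest: "{..<n} - {i} = table_arc n (Suc i) (n - 1)"
      using table_arc_remove[of 0 n n i] n i by (simp add: circle)
    \<comment> \<open>The last napkin of the row that starts at \<open>i + 1\<close> is the left napkin of place \<open>i\<close>.\<close>
    have wrap: "(Suc i + (n - 1)) mod n = i" using n i by simp
    have apart: "(Suc i + j) mod n \<noteq> i" if "j < n - 1" for j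
      using mod_shift_eq_iff[of "j" n "n - 1" "Suc i"] that n i by simp
    have apart': "(Suc i + j) mod n \<noteq> Suc i mod n" if "0 < j" "j < n" for j
      using mod_shift_eq_iff[of "j" n 0 "Suc i"] that n i by simp
    show "mean_weight y z n {i} ({..<n} - {i}) = arc_value y z (n - 1) False True"
      unfolding arc_rest using n apart[of 0] wrap apart
      by (subst mean_weight_table_arc) auto
    have "mean_weight y z n {Suc i mod n} ({..<n} - {i}) = arc_value y z (n - 1) True False"
      unfolding arc_rest using n apart[of 0] wrap apart'
      by (subst mean_weight_table_arc) auto
    thus "mean_weight y z n {Suc i mod n} ({..<n} - {i}) = arc_value y z (n - 1) False True"
      by (simp add: arc_value_commute)
  qed
  show ?thesis
    using assms
    by (subst mean_weight_first) (auto simp: left_napkin_def right_napkin_def step)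
qed

unbundle no vec_syntax
unbundle fps_syntax

section \<open>The generating functions of rows\<close>


definition arc_gf :: "real \<Rightarrow> real \<Rightarrow> bool \<Rightarrow> bool \<Rightarrow> real fps" where
  "arc_gf y z a b = Abs_fps (\<lambda>l. arc_value y z l a b)"

text \<open>
  The recursion of \<open>arc_value\<close> as a system of differential equations. With \<open>A\<close>, \<open>B\<close>, \<open>C\<close> for the
  series with no, one, or both end napkins gone, it reads \<open>A' = A B\<close>, \<open>2 B' = B\<^sup>2 + A C + z B\<close> and
  \<open>C' = B C + z C + y\<close>.
\<close>

lemma fps_deriv_arc_gf:
  "fps_deriv (arc_gf y z a b) =
     fps_const (1/2) * (arc_gf y z a True * arc_gf y z False b + arc_gf y z a False * arc_gf y z True b) +
     (if a then fps_const (z/2) * arc_gf y z True b else 0) +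
     (if b then fps_const (z/2) * arc_gf y z a True else 0) +
     (if a \<and> b then fps_const y else 0)"
proof (rule fps_ext)
  fix l
  have "(\<Sum>i\<le>l. (arc_value y z i a True * arc_value y z (l - i) False b +
               arc_value y z i a False * arc_value y z (l - i) True b) / 2) =
        (fps_const (1/2) * (arc_gf y z a True * arc_gf y z False b + arc_gf y z a False * arc_gf y z True b)) $ l"
    unfolding fps_mult_left_const_nth
    by (simp add: arc_gf_def fps_mult_nth atLeast0AtMost sum.distrib sum_divide_distrib add_divide_distrib)
  moreover have "fps_deriv (arc_gf y z a b) $ l = real (Suc l) * arc_value y z (Suc l) a b"
    by (simp add: arc_gf_def del: arc_value.simps)
  ultimately show "fps_deriv (arc_gf y z a b) $ l =
     (fps_const (1/2) * (arc_gf y z a True * arc_gf y z False b + arc_gf y z a False * arc_gf y z True b) +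
     (if a then fps_const (z/2) * arc_gf y z True b else 0) +
     (if b then fps_const (z/2) * arc_gf y z a True else 0) +
     (if a \<and> b then fps_const y else 0)) $ l"
    unfolding fps_add_nth by (simp add: arc_gf_def del: fps_mult_left_const_nth) (simp add: arc_gf_def)
qed

definition free_arc_inverse :: "real \<Rightarrow> real \<Rightarrow> real fps" where
  "free_arc_inverse y z = inverse (arc_gf y z False False)"

text \<open>
  The system above is of Riccati type, and passing to \<open>D = 1 / A\<close> linearizes it. From \<open>B = - D' / D\<close>, the
  equation for \<open>B'\<close> gives \<open>C = - B D' - 2 D'' + z D'\<close>; substituting this into the equation for \<open>C'\<close>,
  all nonlinear terms cancel.
\<close>

lemma free_arc_inverse_ode:
  fixes y z :: real
  defines "D \<equiv> free_arc_inverse y z" and "B \<equiv> arc_gf y z False True"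
  shows "fps_deriv D = - (B * D)"
    and "2 * fps_deriv (fps_deriv (fps_deriv D)) =
           fps_const (3 * z) * fps_deriv (fps_deriv D) - fps_const (z\<^sup>2) * fps_deriv D - fps_const y"
    and "D $ 0 = 1" and "D $ 1 = -1" and "D $ 2 = (1 - z) / 4"
proof -
  define A C where "A = arc_gf y z False False" and "C = arc_gf y z True True"
  have B_comm: "arc_gf y z True False = B"
    by (simp add: B_def arc_gf_def arc_value_commute)
  have A0: "A $ 0 = 1" and B0: "B $ 0 = 1" and C0: "C $ 0 = 0"
    by (simp_all add: A_def B_def C_def arc_gf_def)
  have half: "fps_const (1/2) * (F + F) = F" for F :: "real fps"
    by (simp add: fps_eq_iff)
  have A': "fps_deriv A = A * B"
    using fps_deriv_arc_gf[of y z False False] half[of "A * B"]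
    by (simp add: B_comm mult.commute flip: A_def B_def)
  have half_z: "fps_const (z/2) * F + fps_const (z/2) * F = fps_const z * F" for F :: "real fps"
    by (simp add: fps_eq_iff)
  have B': "2 * fps_deriv B = B\<^sup>2 + A * C + fps_const z * B"
  proof -
    have "fps_deriv B = fps_const (1/2) * (B * B + A * C) + fps_const (z/2) * B"
      using fps_deriv_arc_gf[of y z False True] by (simp flip: A_def B_def C_def)
    hence "2 * fps_deriv B = fps_const (1/2) * ((B * B + A * C) + (B * B + A * C)) +
        (fps_const (z/2) * B + fps_const (z/2) * B)"
      by (simp only: distrib_left mult_2 ac_simps)
    thus ?thesis by (simp only: half half_z power2_eq_square)
  qed
  have C': "fps_deriv C = B * C + fps_const z * C + fps_const y"
  proof -
    have "fps_deriv C = fps_const (1/2) * (B * C + B * C) + (fps_const (z/2) * C + fps_const (z/2) * C) + fps_const y"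
      using fps_deriv_arc_gf[of y z True True]
      by (simp add: B_comm mult.commute[of C B] flip: A_def B_def C_def)
    thus ?thesis by (simp only: half half_z)
  qed
  have AD: "A * D = 1"
    using A0 inverse_mult_eq_1'[of A] by (simp add: D_def free_arc_inverse_def A_def)
  have "fps_deriv (A * D) = 0" by (simp add: AD)
  hence "A * fps_deriv D + A * B * D = 0"
    by (simp add: A' add.commute)
  hence "A * (fps_deriv D + B * D) = 0" by (simp add: algebra_simps)
  moreover have "A \<noteq> 0" using A0 by auto
  ultimately show D1: "fps_deriv D = - (B * D)"
    by (simp add: eq_neg_iff_add_eq_0)
  define B1 where "B1 = fps_deriv B"
  define D2 where "D2 = fps_deriv (fps_deriv D)"
  define D3 where "D3 = fps_deriv D2"
  have D2: "D2 = - (B1 * D) + B * B * D"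
    unfolding D2_def D1 by (simp add: D1 B1_def algebra_simps)
  have C_eq: "C = B * B * D - 2 * D2 - fps_const z * B * D"
  proof -
    have "A * C = 2 * B1 - B\<^sup>2 - fps_const z * B"
      using B' by (simp add: B1_def)
    hence "D * (A * C) = D * (2 * B1 - B\<^sup>2 - fps_const z * B)" by simp
    moreover have "D * (A * C) = C" using AD by (metis mult.assoc mult.commute mult_1)
    ultimately have "C = D * (2 * B1 - B\<^sup>2 - fps_const z * B)" by simp
    thus ?thesis
      unfolding D2 by (simp add: algebra_simps power2_eq_square)
  qed
  have two: "fps_deriv (2 :: real fps) = 0" by (metis fps_deriv_numeral)
  have "fps_deriv C = 2 * B * B1 * D - B * B * B * D - 2 * D3 - fps_const z * B1 * D + fps_const z * B * B * D"
    unfolding C_eq by (simp add: D1 B1_def D3_def two algebra_simps)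
  hence "2 * D3 = 2 * B * B1 * D - B * B * B * D - fps_const z * B1 * D + fps_const z * B * B * D
      - (B * C + fps_const z * C + fps_const y)"
    unfolding C' by (simp add: algebra_simps)
  also have "\<dots> = 3 * fps_const z * D2 + fps_const z * fps_const z * (B * D) - fps_const y"
    unfolding C_eq D2 by (simp add: algebra_simps)
  also have "\<dots> = fps_const (3 * z) * D2 - fps_const (z\<^sup>2) * fps_deriv D - fps_const y"
    by (simp add: D1 power2_eq_square fps_numeral_fps_const)
  finally show "2 * fps_deriv (fps_deriv (fps_deriv D)) =
           fps_const (3 * z) * fps_deriv (fps_deriv D) - fps_const (z\<^sup>2) * fps_deriv D - fps_const y"
    unfolding D3_def D2_def .
  show D_0: "D $ 0 = 1"
    using A0 by (simp add: D_def free_arc_inverse_def flip: A_def)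
  show D_1: "D $ 1 = -1"
    using arg_cong[OF D1, of "\<lambda>F. F $ 0"] B0 D_0 by simp
  have "2 * B1 $ 0 = 1 + z"
    using arg_cong[OF B', of "\<lambda>F. F $ 0"] A0 B0 C0
    by (simp add: fps_numeral_fps_const power2_eq_square B1_def)
  moreover have "2 * D $ 2 = - (B1 $ 0) + 1"
    using arg_cong[OF D2, of "\<lambda>F. F $ 0"] B0 D_0
    by (simp add: D2_def numeral_2_eq_2)
  ultimately show "D $ 2 = (1 - z) / 4"
    by (simp add: field_simps)
qed

text \<open>
  The characteristic roots of the linear equation are \<open>0\<close>, \<open>z / 2\<close> and \<open>z\<close>, which accounts for the
  geometric terms; only the coefficients of index 0 and 1 see the polynomial part of the solution.
\<close>

definition inv_coeff :: "real \<Rightarrow> real \<Rightarrow> nat \<Rightarrow> real" where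
  "inv_coeff y z k =
     (if k = 0 then 1 else if k = 1 then -1
      else (((1 - z) / 2 - (1 - y / z)) / 2 ^ (k - 2) + (1 - y / z)) * z ^ (k - 2) / fact k)"

lemma free_arc_inverse_nth:
  assumes z: "z \<noteq> 0"
  shows "free_arc_inverse y z $ k = inv_coeff y z k"
proof -
  define D where "D = free_arc_inverse y z"
  define p q where "p = (1 - z) / 2 - (1 - y / z)" and "q = 1 - y / z"
  note ode = free_arc_inverse_ode[of y z, folded D_def]
  have rec: "2 * (fact (k + 3) * D $ (k + 3)) =
          3 * z * (fact (k + 2) * D $ (k + 2)) - z\<^sup>2 * (fact (k + 1) * D $ (k + 1)) - (if k = 0 then y else 0)" for k
  proof -
    have "2 * (real (k + 3) * real (k + 2) * real (k + 1) * D $ (k + 3)) =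
      3 * z * (real (k + 2) * real (k + 1) * D $ (k + 2)) - z\<^sup>2 * (real (k + 1) * D $ (k + 1)) - (if k = 0 then y else 0)"
      using arg_cong[OF ode(2), of "\<lambda>F. F $ k"]
      by (simp add: fps_numeral_fps_const eval_nat_numeral add_ac mult_ac)
    hence "fact k * (2 * (real (k + 3) * real (k + 2) * real (k + 1) * D $ (k + 3))) =
      fact k * (3 * z * (real (k + 2) * real (k + 1) * D $ (k + 2)) - z\<^sup>2 * (real (k + 1) * D $ (k + 1)) - (if k = 0 then y else 0))"
      by (rule arg_cong)
    thus ?thesis
      by (simp add: eval_nat_numeral algebra_simps split: if_splits)
  qed
  have main: "fact (k + 2) * D $ (k + 2) = (p / 2 ^ k + q) * z ^ k" for k
  proof (induction k rule: induct_nat_012)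
    case 0
    show ?case using ode by (simp add: p_def q_def numeral_2_eq_2)
  next
    case 1
    have "2 * (fact 3 * D $ 3) = 3 * z * (1 - z) / 2 + z\<^sup>2 - y"
      using rec[of 0] ode by (simp add: numeral_2_eq_2)
    also have "\<dots> = 2 * ((p / 2 + q) * z)"
      using z by (simp add: p_def q_def field_simps power2_eq_square)
    finally show ?case by (simp add: eval_nat_numeral)
  next
    case (ge2 k)
    have "2 * (fact (Suc (Suc k) + 2) * D $ (Suc (Suc k) + 2)) =
        3 * z * (fact (Suc k + 2) * D $ (Suc k + 2)) - z\<^sup>2 * (fact (k + 2) * D $ (k + 2))"
      using rec[of "Suc k"] by (simp only: numeral_3_eq_3 numeral_2_eq_2 One_nat_def add_Suc_right add_Suc add_0_right nat.distinct if_False diff_zero)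
    also have "\<dots> = 2 * ((p / 2 ^ Suc (Suc k) + q) * z ^ Suc (Suc k))"
      unfolding ge2 by (simp add: field_simps power2_eq_square)
    finally show ?case by simp
  qed
  show ?thesis
  proof (cases "k \<ge> 2")
    case True
    then obtain j where "k = j + 2" by (metis add.commute le_Suc_ex)
    moreover have "D $ (j + 2) = (p / 2 ^ j + q) * z ^ j / fact (j + 2)"
      unfolding main[of j, symmetric] by (simp del: fact_Suc)
    ultimately show ?thesis
      by (simp add: inv_coeff_def p_def q_def D_def del: fact_Suc)
  next
    case False
    hence "k = 0 \<or> k = 1" by auto
    with ode show ?thesis by (auto simp: inv_coeff_def D_def)
  qed
qed

section \<open>Moments of linear combinations\<close>

text \<open>
  All linear combinations of \<open>o\<close> and \<open>m\<close> are treated at once. The variance of \<open>o + m\<close> then yields the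
  covariance.
\<close>

definition stat :: "real \<Rightarrow> real \<Rightarrow> nat \<Rightarrow> nat list \<times> (nat \<Rightarrow> bool) \<Rightarrow> real" where
  "stat \<alpha> \<beta> n \<omega> = \<alpha> * num_napkinless n \<omega> + \<beta> * num_frustrated n \<omega>"

lemma finite_table_pmf [simp]: "finite (set_pmf (table_pmf (1/2) n))"
  by (simp add: table_pmf_def)

lemma integrable_table_pmf:
  fixes h :: "nat list \<times> (nat \<Rightarrow> bool) \<Rightarrow> real"
  shows "integrable (measure_pmf (table_pmf (1/2) n)) h"
  by (intro integrable_measure_pmf_finite) simp

text \<open>
  The moment generating function of \<open>\<alpha> o + \<beta> m\<close> is the mean weight along the curve
  \<open>y = exp (\<alpha> t)\<close>, \<open>z = exp (\<beta> t)\<close>.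
\<close>

lemma expectation_exp_stat:
  assumes "n > 0"
  shows "measure_pmf.expectation (table_pmf (1/2) n) (\<lambda>\<omega>. exp (t * stat \<alpha> \<beta> n \<omega>)) =
         arc_value (exp (\<alpha> * t)) (exp (\<beta> * t)) (n - 1) False True"
proof -
  have weight: "prod_list (map (outcome_weight y z) cs) =
      y ^ count_list cs Napkinless * z ^ count_list cs Frustrated" for y z cs
    by (induction cs) (auto simp: outcome_weight_def split: outcome.splits)
  have "exp (t * stat \<alpha> \<beta> n (xs, f)) = seating_weight (exp (\<alpha> * t)) (exp (\<beta> * t)) n f {} xs" for xs f
    by (simp add: stat_def num_outcome_def seating_weight_def weight exp_add exp_of_nat_mult[symmetric] algebra_simps)
  hence "measure_pmf.expectation (table_pmf (1/2) n) (\<lambda>\<omega>. exp (t * stat \<alpha> \<beta> n \<omega>)) =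
      mean_weight (exp (\<alpha> * t)) (exp (\<beta> * t)) n {} {..<n}"
    unfolding table_pmf_def mean_weight_def by (intro Bochner_Integration.integral_cong) auto
  thus ?thesis by (simp add: mean_weight_circle assms)
qed

lemma expectation_exp_has_derivative:
  fixes g s :: "'a \<Rightarrow> real"
  assumes "finite (set_pmf p)"
  shows "((\<lambda>t. measure_pmf.expectation p (\<lambda>\<omega>. g \<omega> * exp (t * s \<omega>))) has_real_derivative
           measure_pmf.expectation p (\<lambda>\<omega>. g \<omega> * s \<omega> * exp (t * s \<omega>))) (at t)"
proof -
  have eq: "measure_pmf.expectation p h = (\<Sum>\<omega>\<in>set_pmf p. pmf p \<omega> * h \<omega>)" for h :: "'a \<Rightarrow> real"
    using assms by (subst integral_measure_pmf[of "set_pmf p"]) auto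
  show ?thesis
    unfolding eq by (auto intro!: derivative_eq_intros sum.cong simp: mult_ac)
qed

text \<open>
  Derivatives with respect to a real parameter \<open>t\<close>, coefficient by coefficient. They commute
  with the formal derivative \<open>fps_deriv\<close> with respect to the power series variable and obey the
  product rule, so identities between power series that depend on \<open>t\<close> may be differentiated in \<open>t\<close>.
\<close>

definition fps_has_deriv :: "(real \<Rightarrow> real fps) \<Rightarrow> real fps \<Rightarrow> real \<Rightarrow> bool" where
  "fps_has_deriv F F' t \<longleftrightarrow> (\<forall>k. ((\<lambda>t. F t $ k) has_real_derivative F' $ k) (at t))"

lemma fps_has_deriv_unique: "fps_has_deriv F F' t \<Longrightarrow> fps_has_deriv F F'' t \<Longrightarrow> F' = F''"
  unfolding fps_has_deriv_def fps_eq_iff by (meson DERIV_unique)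

lemma fps_has_deriv_add:
  "fps_has_deriv F F' t \<Longrightarrow> fps_has_deriv G G' t \<Longrightarrow> fps_has_deriv (\<lambda>t. F t + G t) (F' + G') t"
  by (auto simp: fps_has_deriv_def intro!: derivative_intros)

lemma fps_has_deriv_minus: "fps_has_deriv F F' t \<Longrightarrow> fps_has_deriv (\<lambda>t. - F t) (- F') t"
  by (auto simp: fps_has_deriv_def intro!: derivative_intros)

lemma fps_has_deriv_mult:
  assumes "fps_has_deriv F F' t" "fps_has_deriv G G' t"
  shows "fps_has_deriv (\<lambda>t. F t * G t) (F' * G t + F t * G') t"
  using assms unfolding fps_has_deriv_def fps_mult_nth fps_add_nth
  by (auto intro!: derivative_eq_intros simp: sum.distrib mult_ac)

lemma fps_has_deriv_fps_deriv:
  "fps_has_deriv F F' t \<Longrightarrow> fps_has_deriv (\<lambda>t. fps_deriv (F t)) (fps_deriv F') t"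
  by (auto simp: fps_has_deriv_def intro!: derivative_eq_intros)

text \<open>
  Normalized such that the coefficients of index \<open>k \<ge> 2\<close> are \<open>a ^ (k - 2) / k!\<close>, the shape in which
  the geometric terms of \<open>inv_coeff\<close> appear.
\<close>

definition exp_tail :: "real \<Rightarrow> real fps" where
  "exp_tail a = fps_const (1 / a\<^sup>2) * (fps_exp a - 1 - fps_const a * fps_X)"

lemma exp_tail_nth: "a \<noteq> 0 \<Longrightarrow> exp_tail a $ k = (if k < 2 then 0 else a ^ (k - 2) / fact k)"
proof (cases "k \<ge> 2")
  case True
  then obtain j where "k = j + 2" by (metis add.commute le_Suc_ex)
  moreover assume "a \<noteq> 0"
  ultimately show ?thesis by (simp add: exp_tail_def power_add power2_eq_square del: fact_Suc)
next
  case False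
  hence "k = 0 \<or> k = 1" by auto
  moreover assume "a \<noteq> 0"
  ultimately show ?thesis by (auto simp: exp_tail_def)
qed

text \<open>
  The coefficients of \<open>exp_tail\<close> times \<open>k - 2\<close>; this factor arises when \<open>z ^ (k - 2)\<close> is
  differentiated.
\<close>

definition weighted_exp_tail :: "real \<Rightarrow> real fps" where
  "weighted_exp_tail a = fps_X * fps_deriv (exp_tail a) - 2 * exp_tail a"

lemma weighted_exp_tail_nth:
  "a \<noteq> 0 \<Longrightarrow> weighted_exp_tail a $ k = real (k - 2) * (if k < 2 then 0 else a ^ (k - 2) / fact k)"
proof -
  assume a: "a \<noteq> 0"
  have "weighted_exp_tail a $ k = (real k - 2) * exp_tail a $ k"
    by (cases k) (simp_all add: weighted_exp_tail_def fps_numeral_fps_const algebra_simps)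
  thus ?thesis by (auto simp: exp_tail_nth[OF a])
qed

text \<open>
  The first and the second derivative at \<open>t = 0\<close> of \<open>1 / A\<close> along the curve \<open>y = exp (\<alpha> t)\<close>,
  \<open>z = exp (\<beta> t)\<close>; see \<open>free_arc_inverse_jet\<close>.
\<close>

definition jet1 :: "real \<Rightarrow> real \<Rightarrow> real fps" where
  "jet1 \<alpha> \<beta> = fps_const (\<alpha> - 3 / 2 * \<beta>) * exp_tail (1/2) + fps_const (\<beta> - \<alpha>) * exp_tail 1"

definition jet2 :: "real \<Rightarrow> real \<Rightarrow> real fps" where
  "jet2 \<alpha> \<beta> = fps_const ((\<alpha> - \<beta>)\<^sup>2 - \<beta>\<^sup>2 / 2) * exp_tail (1/2) - fps_const ((\<alpha> - \<beta>)\<^sup>2) * exp_tail 1 +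
     fps_const (2 * \<beta>) * (fps_const (\<alpha> - 3 / 2 * \<beta>) * weighted_exp_tail (1/2) +
                          fps_const (\<beta> - \<alpha>) * weighted_exp_tail 1)"

lemma free_arc_inverse_exp_nth:
  "free_arc_inverse (exp (\<alpha> * t)) (exp (\<beta> * t)) $ k =
     (if k = 0 then 1 else if k = 1 then -1
      else (((1 - exp (\<beta> * t)) / 2 - (1 - exp ((\<alpha> - \<beta>) * t))) / 2 ^ (k - 2) + (1 - exp ((\<alpha> - \<beta>) * t))) *
           exp (\<beta> * real (k - 2) * t) / fact k)"
proof -
  have "exp (\<alpha> * t) / exp (\<beta> * t) = exp ((\<alpha> - \<beta>) * t)"
    by (simp add: exp_diff left_diff_distrib)
  moreover have "exp (\<beta> * t) ^ j = exp (\<beta> * real j * t)" for j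
    by (simp add: exp_of_nat_mult[symmetric] mult_ac)
  ultimately show ?thesis
    by (simp add: free_arc_inverse_nth inv_coeff_def)
qed

lemma free_arc_inverse_jet:
  fixes \<alpha> \<beta> :: real
  defines "F \<equiv> \<lambda>t. free_arc_inverse (exp (\<alpha> * t)) (exp (\<beta> * t))"
  obtains F1 where "\<And>t. fps_has_deriv F (F1 t) t" "fps_has_deriv F1 (jet2 \<alpha> \<beta>) 0"
    "F 0 = 1 - fps_X" "F1 0 = jet1 \<alpha> \<beta>"
proof
  \<comment> \<open>The amplitudes of the exponentials with rates \<open>z\<close> and \<open>z / 2\<close>; both vanish at \<open>t = 0\<close>, where \<open>y = z = 1\<close>.\<close>
  define Q where "Q = (\<lambda>t. 1 - exp ((\<alpha> - \<beta>) * t))"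
  define P where "P = (\<lambda>t. (1 - exp (\<beta> * t)) / 2 - Q t)"
  define Q1 where "Q1 = (\<lambda>t. - (\<alpha> - \<beta>) * exp ((\<alpha> - \<beta>) * t))"
  define P1 where "P1 = (\<lambda>t. - \<beta> * exp (\<beta> * t) / 2 - Q1 t)"
  define F1 where "F1 = (\<lambda>t. Abs_fps (\<lambda>k. if k < 2 then 0 else
    ((P1 t / 2 ^ (k - 2) + Q1 t) + (P t / 2 ^ (k - 2) + Q t) * (\<beta> * real (k - 2))) *
       exp (\<beta> * real (k - 2) * t) / fact k))"
  have Q': "(Q has_real_derivative Q1 t) (at t)" for t
    unfolding Q_def Q1_def by (auto intro!: derivative_eq_intros simp: algebra_simps)
  have P': "(P has_real_derivative P1 t) (at t)" for t
    unfolding P_def P1_def by (auto intro!: derivative_eq_intros Q')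
  have Q1': "(Q1 has_real_derivative - (\<alpha> - \<beta>)\<^sup>2) (at 0)"
    unfolding Q1_def by (auto intro!: derivative_eq_intros simp: power2_eq_square algebra_simps)
  have P1': "(P1 has_real_derivative (\<alpha> - \<beta>)\<^sup>2 - \<beta>\<^sup>2 / 2) (at 0)"
    unfolding P1_def by (auto intro!: derivative_eq_intros Q1' simp: power2_eq_square)
  have F_nth: "F t $ k = (if k = 0 then 1 else if k = 1 then -1 else
      (P t / 2 ^ (k - 2) + Q t) * exp (\<beta> * real (k - 2) * t) / fact k)" for t k
    by (simp add: F_def free_arc_inverse_exp_nth P_def Q_def)
  have [simp]: "P 0 = 0" "Q 0 = 0" "Q1 0 = \<beta> - \<alpha>" "P1 0 = \<alpha> - 3 / 2 * \<beta>"
    by (simp_all add: P_def Q_def P1_def Q1_def)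
  show "fps_has_deriv F (F1 t) t" for t
    unfolding fps_has_deriv_def
  proof
    fix k
    show "((\<lambda>t. F t $ k) has_real_derivative F1 t $ k) (at t)"
    proof (cases "k < 2")
      case True
      hence "k = 0 \<or> k = 1" by auto
      thus ?thesis by (auto simp: F_nth F1_def)
    next
      case False
      thus ?thesis
        unfolding F_nth F1_def
        by (auto intro!: derivative_eq_intros P' Q' simp: field_simps)
    qed
  qed
  show "fps_has_deriv F1 (jet2 \<alpha> \<beta>) 0"
    unfolding fps_has_deriv_def
  proof
    fix k
    have half: "(1 / 2 :: real) ^ j = 1 / 2 ^ j" for j by (simp add: power_one_over)
    show "((\<lambda>t. F1 t $ k) has_real_derivative jet2 \<alpha> \<beta> $ k) (at 0)"
    proof (cases "k < 2")
      case True
      thus ?thesis by (simp add: F1_def jet2_def exp_tail_nth weighted_exp_tail_nth)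
    next
      case False
      define r w c where "r = real (k - 2)" and "w = 1 / (2 :: real) ^ (k - 2)"
        and "c = 1 / (fact k :: real)"
      have nth: "exp_tail (1/2) $ k = w * c" "exp_tail 1 $ k = c"
          "weighted_exp_tail (1/2) $ k = r * (w * c)" "weighted_exp_tail 1 $ k = r * c"
        using False by (simp_all add: exp_tail_nth weighted_exp_tail_nth half r_def w_def c_def)
      have jet: "jet2 \<alpha> \<beta> $ k =
          (((\<alpha> - \<beta>)\<^sup>2 - \<beta>\<^sup>2 / 2) * w - (\<alpha> - \<beta>)\<^sup>2 +
           2 * (\<beta> * r) * ((\<alpha> - 3 / 2 * \<beta>) * w + (\<beta> - \<alpha>))) * c"
        unfolding jet2_def by (simp add: nth algebra_simps)
      have F1_eq: "F1 t $ k =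
          ((P1 t * w + Q1 t) + (P t * w + Q t) * (\<beta> * r)) * exp (\<beta> * r * t) * c" for t
        using False by (simp add: F1_def r_def w_def c_def)
      show ?thesis
        unfolding F1_eq jet
        by (auto intro!: derivative_eq_intros P' Q' P1' Q1' simp: algebra_simps)
    qed
  qed
  show "F 0 = 1 - fps_X"
    by (auto simp: fps_eq_iff F_nth)
  show "F1 0 = jet1 \<alpha> \<beta>"
    by (auto simp: fps_eq_iff F1_def jet1_def exp_tail_nth power_one_over field_simps)
qed

text \<open>
  Since \<open>B = - (log D)'\<close>, the moment generating function for \<open>n\<close> guests is \<open>n\<close> times the coefficient
  of \<open>x ^ n\<close> in \<open>- log D\<close>. At \<open>t = 0\<close> the series \<open>D\<close> is \<open>1 - x\<close>, with inverse \<open>G\<close>, so the first and second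
  derivative of \<open>- log D\<close> in \<open>t\<close> are \<open>- G D\<^sub>1\<close> and \<open>(G D\<^sub>1)\<^sup>2 - G D\<^sub>2\<close> with the jets \<open>D\<^sub>1\<close>, \<open>D\<^sub>2\<close> of \<open>D\<close>. The
  proof works with \<open>B\<close> and \<open>D' = - B D\<close> in place of the logarithm.
\<close>

lemma stat_moments_gf:
  fixes \<alpha> \<beta> :: real
  defines "G \<equiv> Abs_fps (\<lambda>_. 1 :: real)"
  defines "S \<equiv> G * jet1 \<alpha> \<beta>"
  assumes "n > 0"
  shows "measure_pmf.expectation (table_pmf (1/2) n) (stat \<alpha> \<beta> n) = - (real n * S $ n)"
    and "measure_pmf.expectation (table_pmf (1/2) n) (\<lambda>\<omega>. (stat \<alpha> \<beta> n \<omega>)\<^sup>2) =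
           real n * (S\<^sup>2 - G * jet2 \<alpha> \<beta>) $ n"
proof -
  let ?E = "\<lambda>n. measure_pmf.expectation (table_pmf (1/2) n)"
  define B where "B = (\<lambda>t. arc_gf (exp (\<alpha> * t)) (exp (\<beta> * t)) False True)"
  define B1 where "B1 = (\<lambda>t. Abs_fps (\<lambda>k. ?E (Suc k) (\<lambda>\<omega>. stat \<alpha> \<beta> (Suc k) \<omega> * exp (t * stat \<alpha> \<beta> (Suc k) \<omega>))))"
  define B2 where "B2 = (\<lambda>t. Abs_fps (\<lambda>k. ?E (Suc k) (\<lambda>\<omega>. (stat \<alpha> \<beta> (Suc k) \<omega>)\<^sup>2 * exp (t * stat \<alpha> \<beta> (Suc k) \<omega>))))"
  define F where "F = (\<lambda>t. free_arc_inverse (exp (\<alpha> * t)) (exp (\<beta> * t)))"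
  obtain F1 where F1: "\<And>t. fps_has_deriv F (F1 t) t" "fps_has_deriv F1 (jet2 \<alpha> \<beta>) 0"
    and F_0: "F 0 = 1 - fps_X" "F1 0 = jet1 \<alpha> \<beta>"
    using free_arc_inverse_jet[of \<alpha> \<beta>] unfolding F_def by blast
  have B_nth: "B t $ k = ?E (Suc k) (\<lambda>\<omega>. 1 * exp (t * stat \<alpha> \<beta> (Suc k) \<omega>))" for t k
    by (simp add: B_def arc_gf_def expectation_exp_stat)
  have B': "fps_has_deriv B (B1 t) t" for t
    unfolding fps_has_deriv_def B_nth B1_def fps_nth_Abs_fps
    using expectation_exp_has_derivative[OF finite_table_pmf, where g = "\<lambda>_. 1"] by simp
  have B1': "fps_has_deriv B1 (B2 t) t" for t
    unfolding fps_has_deriv_def B1_def B2_def fps_nth_Abs_fps power2_eq_square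
    by (intro allI expectation_exp_has_derivative finite_table_pmf)
  have ode: "fps_deriv (F t) = - (B t * F t)" for t
    unfolding F_def B_def by (rule free_arc_inverse_ode)
  have ode1: "fps_deriv (F1 t) = - (B1 t * F t + B t * F1 t)" for t
    using fps_has_deriv_unique[OF fps_has_deriv_fps_deriv[OF F1(1)]]
      fps_has_deriv_minus[OF fps_has_deriv_mult[OF B' F1(1)]]
    unfolding ode by blast
  have ode2: "fps_deriv (jet2 \<alpha> \<beta>) =
      - ((B2 0 * F 0 + B1 0 * F1 0) + (B1 0 * F1 0 + B 0 * jet2 \<alpha> \<beta>))"
    using fps_has_deriv_unique[OF fps_has_deriv_fps_deriv[OF F1(2)]]
      fps_has_deriv_minus[OF fps_has_deriv_add[OF fps_has_deriv_mult[OF B1' F1(1)] fps_has_deriv_mult[OF B' F1(2)]]]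
    unfolding ode1 by blast
  have B_0: "B 0 = G"
    by (simp add: fps_eq_iff B_nth G_def)
  have G: "G * (1 - fps_X) = 1"
    by (simp add: fps_eq_iff G_def algebra_simps fps_X_mult_nth)
  have cancel: "G * ((1 - fps_X) * H) = H" for H
    using G by (metis mult.assoc mult_1)
  have G': "fps_deriv G = G * G"
  proof -
    have "fps_deriv (G * (1 - fps_X)) = 0" by (simp add: G)
    hence "(1 - fps_X) * fps_deriv G = G" by (simp add: mult.commute)
    thus ?thesis using cancel[of "fps_deriv G"] by simp
  qed
  have B1_0: "B1 0 = - fps_deriv S"
  proof -
    have "(1 - fps_X) * B1 0 = - fps_deriv (jet1 \<alpha> \<beta>) - G * jet1 \<alpha> \<beta>"
      using ode1[of 0] by (simp add: F_0 B_0 algebra_simps)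
    hence "B1 0 = G * (- fps_deriv (jet1 \<alpha> \<beta>) - G * jet1 \<alpha> \<beta>)"
      using cancel by metis
    thus ?thesis by (simp add: S_def G' algebra_simps)
  qed
  have B2_0: "B2 0 = fps_deriv (S\<^sup>2 - G * jet2 \<alpha> \<beta>)"
  proof -
    have "(1 - fps_X) * B2 0 = - fps_deriv (jet2 \<alpha> \<beta>) - 2 * (B1 0 * jet1 \<alpha> \<beta>) - G * jet2 \<alpha> \<beta>"
      using ode2 by (simp add: F_0 B_0 algebra_simps)
    hence "B2 0 = G * (- fps_deriv (jet2 \<alpha> \<beta>) - 2 * (B1 0 * jet1 \<alpha> \<beta>) - G * jet2 \<alpha> \<beta>)"
      using cancel by metis
    thus ?thesis by (simp add: B1_0 S_def G' power2_eq_square algebra_simps)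
  qed
  obtain k where n: "n = Suc k" using assms by (cases n) auto
  show "?E n (stat \<alpha> \<beta> n) = - (real n * S $ n)"
    using arg_cong[OF B1_0, of "\<lambda>H. H $ k"] by (simp add: B1_def n)
  show "?E n (\<lambda>\<omega>. (stat \<alpha> \<beta> n \<omega>)\<^sup>2) = real n * (S\<^sup>2 - G * jet2 \<alpha> \<beta>) $ n"
    using arg_cong[OF B2_0, of "\<lambda>H. H $ k"] unfolding fps_deriv_nth by (simp add: B2_def n)
qed

section \<open>Coefficient asymptotics\<close>

lemma entire_fps_add:
  fixes F G :: "real fps"
  shows "fps_conv_radius F = \<infinity> \<Longrightarrow> fps_conv_radius G = \<infinity> \<Longrightarrow> fps_conv_radius (F + G) = \<infinity>"
  using fps_conv_radius_add[of F G] by simp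

lemma entire_fps_diff:
  fixes F G :: "real fps"
  shows "fps_conv_radius F = \<infinity> \<Longrightarrow> fps_conv_radius G = \<infinity> \<Longrightarrow> fps_conv_radius (F - G) = \<infinity>"
  using fps_conv_radius_diff[of F G] by simp

lemma entire_fps_mult:
  fixes F G :: "real fps"
  shows "fps_conv_radius F = \<infinity> \<Longrightarrow> fps_conv_radius G = \<infinity> \<Longrightarrow> fps_conv_radius (F * G) = \<infinity>"
  using fps_conv_radius_mult[of F G] by simp

lemma entire_fps_deriv:
  fixes F :: "real fps"
  shows "fps_conv_radius F = \<infinity> \<Longrightarrow> fps_conv_radius (fps_deriv F) = \<infinity>"
  using fps_conv_radius_deriv[of F] by simp

text \<open>
  The second part holds because the series of \<open>k \<bar>F\<^sub>k\<bar>\<close> converges and its tail after index \<open>n\<close>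
  bounds \<open>n\<close> times the tail of \<open>F\<close>.
\<close>

lemma partial_sums_eval_fps:
  fixes F :: "real fps"
  assumes "fps_conv_radius F = \<infinity>"
  shows "(\<lambda>n. \<Sum>k\<le>n. F $ k) \<longlonglongrightarrow> eval_fps F 1"
    and "(\<lambda>n. real n * ((\<Sum>k\<le>n. F $ k) - eval_fps F 1)) \<longlonglongrightarrow> 0"
proof -
  have sm: "summable (\<lambda>k. norm (H $ k))" if "fps_conv_radius H = \<infinity>" for H :: "real fps"
    using abs_summable_in_conv_radius[of 1 "fps_nth H"] that by (simp add: fps_conv_radius_def)
  have F: "summable (\<lambda>k. norm (F $ k))" by (rule sm[OF assms])
  have "fps_conv_radius (fps_X * fps_deriv F) = \<infinity>"
    by (intro entire_fps_mult entire_fps_deriv assms) simp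
  moreover have nth: "(fps_X * fps_deriv F) $ k = real k * F $ k" for k
    by (cases k) auto
  ultimately have kF: "summable (\<lambda>k. real k * norm (F $ k))"
    using sm[of "fps_X * fps_deriv F"] by (simp add: abs_mult)
  have eval: "eval_fps F 1 = (\<Sum>k. F $ k)" by (simp add: eval_fps_def)
  show "(\<lambda>n. \<Sum>k\<le>n. F $ k) \<longlonglongrightarrow> eval_fps F 1"
    unfolding eval by (rule summable_LIMSEQ'[OF summable_norm_cancel[OF F]])
  show "(\<lambda>n. real n * ((\<Sum>k\<le>n. F $ k) - eval_fps F 1)) \<longlonglongrightarrow> 0"
  proof (rule Lim_null_comparison)
    have "(\<lambda>n. (\<Sum>k. real k * norm (F $ k)) - (\<Sum>k\<le>n. real k * norm (F $ k))) \<longlonglongrightarrow> 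
            (\<Sum>k. real k * norm (F $ k)) - (\<Sum>k. real k * norm (F $ k))"
      by (intro tendsto_intros summable_LIMSEQ' kF)
    thus "(\<lambda>n. (\<Sum>k. real k * norm (F $ k)) - (\<Sum>k\<le>n. real k * norm (F $ k))) \<longlonglongrightarrow> 0"
      by simp
    show "\<forall>\<^sub>F n in sequentially. norm (real n * ((\<Sum>k\<le>n. F $ k) - eval_fps F 1)) \<le>
             (\<Sum>k. real k * norm (F $ k)) - (\<Sum>k\<le>n. real k * norm (F $ k))"
    proof (intro always_eventually allI)
      fix n
      have tail: "(\<Sum>k. h k) - (\<Sum>k\<le>n. h k) = (\<Sum>k. h (k + Suc n))" if "summable h" for h :: "nat \<Rightarrow> real"
        using suminf_minus_initial_segment[OF that, of "Suc n"] by (simp add: lessThan_Suc_atMost)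
      have s1: "summable (\<lambda>k. norm (F $ (k + Suc n)))"
        using F by (subst summable_iff_shift)
      have s2: "summable (\<lambda>k. real (k + Suc n) * norm (F $ (k + Suc n)))"
        using kF by (subst summable_iff_shift[of "\<lambda>k. real k * norm (F $ k)"])
      have "norm (real n * ((\<Sum>k\<le>n. F $ k) - eval_fps F 1)) = real n * norm (\<Sum>k. F $ (k + Suc n))"
        unfolding eval tail[OF summable_norm_cancel[OF F], symmetric]
        by (simp add: abs_mult abs_minus_commute)
      also have "\<dots> \<le> real n * (\<Sum>k. norm (F $ (k + Suc n)))"
        by (intro mult_left_mono summable_norm s1) auto
      also have "\<dots> = (\<Sum>k. real n * norm (F $ (k + Suc n)))"
        by (rule suminf_mult[OF s1, symmetric])
      also have "\<dots> \<le> (\<Sum>k. real (k + Suc n) * norm (F $ (k + Suc n)))"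
        by (intro suminf_le s2 summable_mult s1 mult_right_mono) auto
      also have "\<dots> = (\<Sum>k. real k * norm (F $ k)) - (\<Sum>k\<le>n. real k * norm (F $ k))"
        by (rule tail[OF kF, symmetric])
      finally show "norm (real n * ((\<Sum>k\<le>n. F $ k) - eval_fps F 1)) \<le> \<dots>" .
    qed
  qed
qed

lemma geometric_mult_nth: "(Abs_fps (\<lambda>_. 1 :: real) * F) $ n = (\<Sum>k\<le>n. F $ k)"
  by (subst mult.commute) (simp add: fps_mult_nth atLeast0AtMost)

lemma geometric_square_mult_nth:
  "(Abs_fps (\<lambda>_. 1 :: real) * (Abs_fps (\<lambda>_. 1) * F)) $ n =
     real (Suc n) * (\<Sum>k\<le>n. F $ k) - (\<Sum>k\<le>n. (fps_X * fps_deriv F) $ k)"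
proof -
  have "(fps_X * fps_deriv F) $ k = real k * F $ k" for k
    by (cases k) auto
  thus ?thesis
    unfolding geometric_mult_nth
    by (induction n) (auto simp: algebra_simps)
qed

text \<open>
  The coefficient of \<open>(G F)\<^sup>2\<close> and \<open>n\<close> times the square of the coefficient of \<open>G F\<close> both grow like
  \<open>n (F 1)\<^sup>2\<close>. The partial sums of an entire series converge faster than \<open>1 / n\<close>, so the second
  quantity differs from \<open>n (F 1)\<^sup>2\<close> by \<open>o (1)\<close>, and the first one does so up to the constant that the
  double pole of \<open>F\<^sup>2 / (1 - x)\<^sup>2\<close> at 1 contributes.
\<close>

lemma variance_gf_limit:
  fixes F H :: "real fps"
  defines "G \<equiv> Abs_fps (\<lambda>_. 1 :: real)"
  assumes F: "fps_conv_radius F = \<infinity>" and H: "fps_conv_radius H = \<infinity>"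
  shows "(\<lambda>n. ((G * F)\<^sup>2 - G * H) $ n - real n * ((G * F) $ n)\<^sup>2) \<longlonglongrightarrow>
           (eval_fps F 1)\<^sup>2 - 2 * eval_fps F 1 * eval_fps (fps_deriv F) 1 - eval_fps H 1"
proof -
  define f where "f = eval_fps F 1"
  have F2: "fps_conv_radius (F\<^sup>2) = \<infinity>"
    unfolding power2_eq_square by (intro entire_fps_mult F)
  have F': "fps_conv_radius (fps_deriv F) = \<infinity>"
    by (intro entire_fps_deriv F)
  have FF': "fps_conv_radius (F * fps_deriv F) = \<infinity>"
    by (intro entire_fps_mult F F')
  have dF2: "fps_deriv (F\<^sup>2) = F * fps_deriv F + F * fps_deriv F"
    by (simp add: power2_eq_square mult.commute)
  have XF: "fps_conv_radius (fps_X * fps_deriv (F\<^sup>2)) = \<infinity>"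
    by (intro entire_fps_mult entire_fps_deriv F2) simp
  have eval_XF: "eval_fps (fps_X * fps_deriv (F\<^sup>2)) 1 = 2 * f * eval_fps (fps_deriv F) 1"
  proof -
    have "fps_conv_radius (fps_deriv (F\<^sup>2)) = \<infinity>"
      by (intro entire_fps_deriv F2)
    thus ?thesis
      using F F' FF' by (simp add: eval_fps_mult dF2 eval_fps_add f_def)
  qed
  have eval_F2: "eval_fps (F\<^sup>2) 1 = f\<^sup>2"
    using F by (simp add: power2_eq_square eval_fps_mult f_def)
  define S T where "S = (\<lambda>n. \<Sum>k\<le>n. F $ k)" and "T = (\<lambda>n. \<Sum>k\<le>n. (F\<^sup>2) $ k)"
  have S: "S \<longlonglongrightarrow> f" "(\<lambda>n. real n * (S n - f)) \<longlonglongrightarrow> 0"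
    unfolding S_def f_def by (rule partial_sums_eval_fps[OF F])+
  have T: "T \<longlonglongrightarrow> f\<^sup>2" "(\<lambda>n. real n * (T n - f\<^sup>2)) \<longlonglongrightarrow> 0"
    unfolding T_def eval_F2[symmetric] by (rule partial_sums_eval_fps[OF F2])+
  \<comment> \<open>Adding and subtracting \<open>n f\<^sup>2\<close> leaves only convergent terms.\<close>
  have "(\<lambda>n. real n * (T n - f\<^sup>2) + T n - (\<Sum>k\<le>n. (fps_X * fps_deriv (F\<^sup>2)) $ k) -
           real n * (S n - f) * (S n + f) - (\<Sum>k\<le>n. H $ k)) \<longlonglongrightarrow>
        0 + f\<^sup>2 - 2 * f * eval_fps (fps_deriv F) 1 - 0 * (f + f) - eval_fps H 1"
    by (intro tendsto_intros S T partial_sums_eval_fps(1)[OF H]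
          partial_sums_eval_fps(1)[OF XF, unfolded eval_XF])
  also have "(\<lambda>n. real n * (T n - f\<^sup>2) + T n - (\<Sum>k\<le>n. (fps_X * fps_deriv (F\<^sup>2)) $ k) -
           real n * (S n - f) * (S n + f) - (\<Sum>k\<le>n. H $ k)) =
        (\<lambda>n. ((G * F)\<^sup>2 - G * H) $ n - real n * ((G * F) $ n)\<^sup>2)"
  proof
    fix n
    have "(G * F)\<^sup>2 = G * (G * F\<^sup>2)" by (simp add: power2_eq_square mult_ac)
    hence "((G * F)\<^sup>2) $ n = real (Suc n) * T n - (\<Sum>k\<le>n. (fps_X * fps_deriv (F\<^sup>2)) $ k)"
      unfolding G_def by (simp only: geometric_square_mult_nth T_def)
    moreover have "(G * H) $ n = (\<Sum>k\<le>n. H $ k)" "(G * F) $ n = S n"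
      unfolding G_def S_def by (rule geometric_mult_nth)+
    ultimately show "real n * (T n - f\<^sup>2) + T n - (\<Sum>k\<le>n. (fps_X * fps_deriv (F\<^sup>2)) $ k) -
           real n * (S n - f) * (S n + f) - (\<Sum>k\<le>n. H $ k) =
        ((G * F)\<^sup>2 - G * H) $ n - real n * ((G * F) $ n)\<^sup>2"
      by (simp add: algebra_simps power2_eq_square)
  qed
  finally show ?thesis by (simp add: f_def)
qed

lemma exp_tail_analytic:
  fixes a :: real
  assumes a: "a \<noteq> 0"
  shows "fps_conv_radius (exp_tail a) = \<infinity>" "fps_conv_radius (fps_deriv (exp_tail a)) = \<infinity>"
    "fps_conv_radius (weighted_exp_tail a) = \<infinity>"
    "eval_fps (exp_tail a) 1 = (exp a - 1 - a) / a\<^sup>2"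
    "eval_fps (fps_deriv (exp_tail a)) 1 = (exp a - 1) / a"
    "eval_fps (weighted_exp_tail a) 1 = (exp a - 1) / a - 2 * (exp a - 1 - a) / a\<^sup>2"
proof -
  have X: "fps_conv_radius (fps_const a * fps_X) = \<infinity>" "fps_conv_radius (fps_exp a - 1) = \<infinity>"
    by (intro entire_fps_mult entire_fps_diff; simp)+
  show 1: "fps_conv_radius (exp_tail a) = \<infinity>"
    unfolding exp_tail_def by (intro entire_fps_mult entire_fps_diff X) simp
  show 2: "fps_conv_radius (fps_deriv (exp_tail a)) = \<infinity>"
    by (intro entire_fps_deriv 1)
  have 3: "fps_conv_radius (fps_X * fps_deriv (exp_tail a)) = \<infinity>" "fps_conv_radius (2 * exp_tail a) = \<infinity>"
    by (intro entire_fps_mult 1 2; simp)+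
  show "fps_conv_radius (weighted_exp_tail a) = \<infinity>"
    unfolding weighted_exp_tail_def by (intro entire_fps_diff 3)
  have 4: "fps_conv_radius (fps_exp a - 1 - fps_const a * fps_X) = \<infinity>"
    by (intro entire_fps_diff X)
  show eval: "eval_fps (exp_tail a) 1 = (exp a - 1 - a) / a\<^sup>2"
    using 4 X by (simp add: exp_tail_def eval_fps_mult eval_fps_diff)
  have "fps_deriv (exp_tail a) = fps_const (1 / a) * (fps_exp a - 1)"
    using a by (simp add: exp_tail_def fps_eq_iff power2_eq_square divide_simps)
  thus eval': "eval_fps (fps_deriv (exp_tail a)) 1 = (exp a - 1) / a"
    using X by (simp add: eval_fps_mult eval_fps_diff)
  show "eval_fps (weighted_exp_tail a) 1 = (exp a - 1) / a - 2 * (exp a - 1 - a) / a\<^sup>2"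
    using 1 2 3 eval eval' by (simp add: weighted_exp_tail_def eval_fps_diff eval_fps_mult)
qed

section \<open>Evaluation of the constants\<close>

lemma eval_jet1:
  "eval_fps (jet1 \<alpha> \<beta>) 1 = (\<alpha> - 3/2 * \<beta>) * (4 * exp (1/2) - 6) + (\<beta> - \<alpha>) * (exp 1 - 2)"
  and eval_jet1_deriv:
  "eval_fps (fps_deriv (jet1 \<alpha> \<beta>)) 1 = (\<alpha> - 3/2 * \<beta>) * (2 * (exp (1/2) - 1)) + (\<beta> - \<alpha>) * (exp 1 - 1)"
  and eval_jet2:
  "eval_fps (jet2 \<alpha> \<beta>) 1 =
     ((\<alpha> - \<beta>)\<^sup>2 - \<beta>\<^sup>2 / 2) * (4 * exp (1/2) - 6) - (\<alpha> - \<beta>)\<^sup>2 * (exp 1 - 2) +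
     2 * \<beta> * ((\<alpha> - 3/2 * \<beta>) * (10 - 6 * exp (1/2)) + (\<beta> - \<alpha>) * (3 - exp 1))"
  and conv_radius_jet1: "fps_conv_radius (jet1 \<alpha> \<beta>) = \<infinity>"
  and conv_radius_jet2: "fps_conv_radius (jet2 \<alpha> \<beta>) = \<infinity>"
proof -
  have scale: "fps_conv_radius (fps_const c * F) = \<infinity>" if "fps_conv_radius F = \<infinity>" for F :: "real fps" and c
    by (intro entire_fps_mult that) simp
  note tail = exp_tail_analytic[of 1, simplified] exp_tail_analytic[of "1/2", simplified]
  show "eval_fps (jet1 \<alpha> \<beta>) 1 = (\<alpha> - 3/2 * \<beta>) * (4 * exp (1/2) - 6) + (\<beta> - \<alpha>) * (exp 1 - 2)"
    unfolding jet1_def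
    by (simp add: eval_fps_add eval_fps_mult scale tail)
       (simp add: power2_eq_square field_simps)
  show "eval_fps (fps_deriv (jet1 \<alpha> \<beta>)) 1 = (\<alpha> - 3/2 * \<beta>) * (2 * (exp (1/2) - 1)) + (\<beta> - \<alpha>) * (exp 1 - 1)"
    unfolding jet1_def
    by (simp add: eval_fps_add eval_fps_mult scale tail)
  show "eval_fps (jet2 \<alpha> \<beta>) 1 =
     ((\<alpha> - \<beta>)\<^sup>2 - \<beta>\<^sup>2 / 2) * (4 * exp (1/2) - 6) - (\<alpha> - \<beta>)\<^sup>2 * (exp 1 - 2) +
     2 * \<beta> * ((\<alpha> - 3/2 * \<beta>) * (10 - 6 * exp (1/2)) + (\<beta> - \<alpha>) * (3 - exp 1))"
    unfolding jet2_def
    by (simp add: eval_fps_add eval_fps_diff eval_fps_mult entire_fps_add entire_fps_diff scale tail)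
       (simp add: power2_eq_square field_simps)
  show "fps_conv_radius (jet1 \<alpha> \<beta>) = \<infinity>" "fps_conv_radius (jet2 \<alpha> \<beta>) = \<infinity>"
    unfolding jet1_def jet2_def by (intro entire_fps_add entire_fps_diff scale tail)+
qed

lemma expectation_stat_limit:
  "(\<lambda>n. measure_pmf.expectation (table_pmf (1/2) n) (stat \<alpha> \<beta> n) / real n) \<longlonglongrightarrow> - eval_fps (jet1 \<alpha> \<beta>) 1"
proof (rule Lim_transform_eventually)
  show "(\<lambda>n. - (\<Sum>k\<le>n. jet1 \<alpha> \<beta> $ k)) \<longlonglongrightarrow> - eval_fps (jet1 \<alpha> \<beta>) 1"
    by (intro tendsto_minus partial_sums_eval_fps conv_radius_jet1)
  show "\<forall>\<^sub>F n in sequentially. - (\<Sum>k\<le>n. jet1 \<alpha> \<beta> $ k) =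
          measure_pmf.expectation (table_pmf (1/2) n) (stat \<alpha> \<beta> n) / real n"
    using eventually_gt_at_top[of 0]
    by eventually_elim (simp add: stat_moments_gf geometric_mult_nth)
qed

lemma variance_stat_limit:
  "(\<lambda>n. measure_pmf.variance (table_pmf (1/2) n) (stat \<alpha> \<beta> n) / real n) \<longlonglongrightarrow>
     (eval_fps (jet1 \<alpha> \<beta>) 1)\<^sup>2 - 2 * eval_fps (jet1 \<alpha> \<beta>) 1 * eval_fps (fps_deriv (jet1 \<alpha> \<beta>)) 1
       - eval_fps (jet2 \<alpha> \<beta>) 1"
proof (rule Lim_transform_eventually[OF variance_gf_limit[OF conv_radius_jet1 conv_radius_jet2]])
  show "\<forall>\<^sub>F n in sequentially. ((Abs_fps (\<lambda>_. 1) * jet1 \<alpha> \<beta>)\<^sup>2 - Abs_fps (\<lambda>_. 1) * jet2 \<alpha> \<beta>) $ n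
          - real n * ((Abs_fps (\<lambda>_. 1) * jet1 \<alpha> \<beta>) $ n)\<^sup>2 =
          measure_pmf.variance (table_pmf (1/2) n) (stat \<alpha> \<beta> n) / real n"
    using eventually_gt_at_top[of 0]
  proof eventually_elim
    case (elim n)
    have "a - real n * s\<^sup>2 = (real n * a - (- (real n * s))\<^sup>2) / real n" for a s
      using elim by (simp add: field_simps power2_eq_square)
    thus ?case
      using measure_pmf.variance_eq[OF integrable_table_pmf[of n "stat \<alpha> \<beta> n"] integrable_table_pmf]
      unfolding stat_moments_gf[OF elim] by simp
  qed
qed

lemma asymp_equiv_linearI:
  fixes a g :: "nat \<Rightarrow> real"
  assumes "(\<lambda>n. a n / real n) \<longlonglongrightarrow> c" "c \<noteq> 0" "\<And>n. g n = real n * c"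
  shows "a \<sim>[sequentially] g"
proof (rule asymp_equivI'_const[of _ _ 1 , simplified])
  have "(\<lambda>n. a n / real n / c) \<longlonglongrightarrow> c / c"
    by (intro tendsto_divide assms tendsto_const)
  thus "(\<lambda>n. a n / g n) \<longlonglongrightarrow> 1"
    using assms by simp
qed

lemma covariance_pmf_polarization:
  assumes fin: "finite (set_pmf M)"
  shows "covariance_pmf M X Y =
    (measure_pmf.variance M (\<lambda>x. X x + Y x) - measure_pmf.variance M X - measure_pmf.variance M Y) / 2"
proof -
  have int: "integrable (measure_pmf M) h" for h :: "_ \<Rightarrow> real"
    by (intro integrable_measure_pmf_finite fin)
  let ?E = "measure_pmf.expectation M"
  have "measure_pmf.variance M (\<lambda>x. X x + Y x) =
      ?E (\<lambda>x. (X x - ?E X)\<^sup>2 + ((Y x - ?E Y)\<^sup>2 + 2 * ((X x - ?E X) * (Y x - ?E Y))))"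
    by (simp add: int power2_eq_square algebra_simps)
  also have "\<dots> = measure_pmf.variance M X + (measure_pmf.variance M Y + 2 * covariance_pmf M X Y)"
    unfolding covariance_pmf_def
    by (subst Bochner_Integration.integral_add[OF int int])+
       (simp only: integral_mult_right_zero)
  finally show ?thesis by simp
qed

text \<open>
  Deducing asymptotic equivalence to \<open>n c\<close> from a limit \<open>c\<close> requires \<open>c \<noteq> 0\<close>. The constants of the
  theorem are products of polynomials in the square root of \<open>e\<close>, the smallest of which has a
  value of about 0.08; bounds of this precision separate it from 0.
\<close>

lemma exp_half_bounds: "exp (1/2 :: real) \<in> {(164872/100000)<..<(164873/100000)}"
proof -
  have sq: "(exp (1/2 :: real))\<^sup>2 = exp 1" by (simp flip: exp_double)
  have "\<bar>exp 1 - 5837465777 / 2147483648\<bar> \<le> (1 / 4294967296 :: real)"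
    using e_approx_32 by simp
  hence "((271828/100000) :: real) < exp 1" "exp 1 < ((271829/100000) :: real)"
    unfolding abs_le_iff by linarith+
  moreover have "((164872/100000) :: real)\<^sup>2 < (271828/100000)" "(271829/100000) < ((164873/100000) :: real)\<^sup>2"
    by (simp_all add: power2_eq_square)
  ultimately have "((164872/100000) :: real)\<^sup>2 < exp 1" "exp 1 < ((164873/100000) :: real)\<^sup>2"
    by linarith+
  hence "((164872/100000) :: real)\<^sup>2 < (exp (1/2))\<^sup>2" "(exp (1/2 :: real))\<^sup>2 < (164873/100000)\<^sup>2"
    unfolding sq .
  thus ?thesis
    by (auto dest!: power_less_imp_less_base)
qed

theorem mainTheorem5:
  shows
    "  (\<lambda>n. measure_pmf.expectation (table_pmf (1/2) n) (num_napkinless n))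
       \<sim>[sequentially] (\<lambda>n. real n * (2 - sqrt (exp 1))\<^sup>2)
     \<and> (\<lambda>n. measure_pmf.expectation (table_pmf (1/2) n) (num_frustrated n))
       \<sim>[sequentially] (\<lambda>n. real n * (6 * sqrt (exp 1) - exp 1 - 7))
     \<and> (\<lambda>n. measure_pmf.expectation (table_pmf (1/2) n) (num_happy n))
       \<sim>[sequentially] (\<lambda>n. real n * (4 - 2 * sqrt (exp 1)))
     \<and> (\<lambda>n. measure_pmf.variance (table_pmf (1/2) n) (num_napkinless n))
       \<sim>[sequentially] (\<lambda>n. real n * (3 - exp 1) * (2 - sqrt (exp 1))\<^sup>2)
     \<and> (\<lambda>n. measure_pmf.variance (table_pmf (1/2) n) (num_frustrated n))
       \<sim>[sequentially]
         (\<lambda>n. real n * (6 * sqrt (exp 1 ^ 3) - (exp 1)\<^sup>2 - exp 1 - 38 * sqrt (exp 1) + 46))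
     \<and> (\<lambda>n. covariance_pmf (table_pmf (1/2) n) (num_napkinless n) (num_frustrated n))
       \<sim>[sequentially]
         (\<lambda>n. - real n * (2 - sqrt (exp 1)) *
              (sqrt (exp 1 ^ 3) - 3 * exp 1 - 5 * sqrt (exp 1) + 12))"
proof -
  define r where "r = exp (1/2 :: real)"
  have r: "(164872/100000) < r" "r < (164873/100000)"
    using exp_half_bounds by (auto simp: r_def)
  have e: "exp 1 = r\<^sup>2" by (simp add: r_def flip: exp_double)
  have sqrt_e: "sqrt (exp 1) = r" using r by (simp add: e)
  have sqrt_e3: "sqrt (exp 1 ^ 3) = r ^ 3"
    using r by (simp add: real_sqrt_power sqrt_e)
  have "(164872/100000) ^ 3 \<le> r ^ 3" "r ^ 2 \<le> (164873/100000) ^ 2" "r ^ 4 \<le> (164873/100000) ^ 4" 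
    using r by (intro power_mono; simp)+
  moreover have "((44816/10000) :: real) \<le> (164872/100000) ^ 3" "(164873/100000) ^ 2 \<le> ((27184/10000) :: real)" "(164873/100000) ^ 4 \<le> ((73893/10000) :: real)"
    by (simp_all add: power2_eq_square power3_eq_cube power4_eq_xxxx)
  ultimately have pow: "(44816/10000) \<le> r ^ 3" "r\<^sup>2 \<le> (27184/10000)" "r ^ 4 \<le> (73893/10000)"
    by linarith+
  have pos: "6 * r - r\<^sup>2 - 7 > 0" "3 - r\<^sup>2 > 0" "6 * r ^ 3 - r ^ 4 - r\<^sup>2 - 38 * r + 46 > 0"
      "r ^ 3 - 3 * r\<^sup>2 - 5 * r + 12 > 0" "2 - r > 0"
    using r pow by linarith+
  define f where "f = (\<lambda>\<alpha> \<beta>. (\<alpha> - 3/2 * \<beta>) * (4 * r - 6) + (\<beta> - \<alpha>) * (r\<^sup>2 - 2))"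
  define V where "V = (\<lambda>\<alpha> \<beta>. (f \<alpha> \<beta>)\<^sup>2 -
      2 * f \<alpha> \<beta> * ((\<alpha> - 3/2 * \<beta>) * (2 * (r - 1)) + (\<beta> - \<alpha>) * (r\<^sup>2 - 1)) -
      (((\<alpha> - \<beta>)\<^sup>2 - \<beta>\<^sup>2 / 2) * (4 * r - 6) - (\<alpha> - \<beta>)\<^sup>2 * (r\<^sup>2 - 2) +
       2 * \<beta> * ((\<alpha> - 3/2 * \<beta>) * (10 - 6 * r) + (\<beta> - \<alpha>) * (3 - r\<^sup>2))))"
  have mean: "(\<lambda>n. measure_pmf.expectation (table_pmf (1/2) n) (stat \<alpha> \<beta> n) / real n) \<longlonglongrightarrow> - f \<alpha> \<beta>" for \<alpha> \<beta>
    using expectation_stat_limit[of \<alpha> \<beta>] by (simp add: f_def eval_jet1 e flip: r_def)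
  have var: "(\<lambda>n. measure_pmf.variance (table_pmf (1/2) n) (stat \<alpha> \<beta> n) / real n) \<longlonglongrightarrow> V \<alpha> \<beta>" for \<alpha> \<beta>
    using variance_stat_limit[of \<alpha> \<beta>]
    by (simp only: V_def f_def eval_jet1 eval_jet1_deriv eval_jet2 e flip: r_def)
  have o: "num_napkinless n = stat 1 0 n" and m: "num_frustrated n = stat 0 1 n"
    and om: "stat 1 1 n = (\<lambda>\<omega>. stat 1 0 n \<omega> + stat 0 1 n \<omega>)" for n
    by (auto simp: fun_eq_iff stat_def)
  have f_o: "- f 1 0 = (2 - r)\<^sup>2" and f_m: "- f 0 1 = 6 * r - r\<^sup>2 - 7" and f_om: "- f 1 1 = 2 * r - 3"
    unfolding f_def by (simp_all add: power2_eq_square algebra_simps)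
  have V_o: "V 1 0 = (3 - r\<^sup>2) * (2 - r)\<^sup>2"
    and V_m: "V 0 1 = 6 * r ^ 3 - r ^ 4 - r\<^sup>2 - 38 * r + 46"
    and V_om: "(V 1 1 - V 1 0 - V 0 1) / 2 = - (2 - r) * (r ^ 3 - 3 * r\<^sup>2 - 5 * r + 12)"
    unfolding V_def f_def
    by (simp_all add: power2_eq_square power3_eq_cube power4_eq_xxxx field_simps)

  have happy: "(\<lambda>n. measure_pmf.expectation (table_pmf (1/2) n) (num_happy n) / real n) \<longlonglongrightarrow> 4 - 2 * r"
  proof (rule Lim_transform_eventually)
    show "(\<lambda>n. 1 - measure_pmf.expectation (table_pmf (1/2) n) (stat 1 1 n) / real n) \<longlonglongrightarrow> 4 - 2 * r"
      using tendsto_diff[OF tendsto_const[of 1] mean[of 1 1]] by (simp add: f_om)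
    have "measure_pmf.expectation (table_pmf (1/2) n) (num_happy n) =
        measure_pmf.expectation (table_pmf (1/2) n) (\<lambda>\<omega>. real n - stat 1 1 n \<omega>)" for n
      by (intro integral_cong_AE AE_pmfI) (simp_all add: num_happy_eq stat_def)
    also have "\<dots> n = real n - measure_pmf.expectation (table_pmf (1/2) n) (stat 1 1 n)" for n
      by (subst Bochner_Integration.integral_diff[OF integrable_table_pmf integrable_table_pmf]) simp
    finally have E: "measure_pmf.expectation (table_pmf (1/2) n) (num_happy n) =
        real n - measure_pmf.expectation (table_pmf (1/2) n) (stat 1 1 n)" for n .
    show "\<forall>\<^sub>F n in sequentially. 1 - measure_pmf.expectation (table_pmf (1/2) n) (stat 1 1 n) / real n =
        measure_pmf.expectation (table_pmf (1/2) n) (num_happy n) / real n"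
      using eventually_gt_at_top[of 0] by eventually_elim (simp add: E diff_divide_distrib)
  qed
  have cov: "(\<lambda>n. covariance_pmf (table_pmf (1/2) n) (num_napkinless n) (num_frustrated n) / real n)
      \<longlonglongrightarrow> - (2 - r) * (r ^ 3 - 3 * r\<^sup>2 - 5 * r + 12)"
  proof -
    have "(\<lambda>n. (measure_pmf.variance (table_pmf (1/2) n) (stat 1 1 n) / real n -
               measure_pmf.variance (table_pmf (1/2) n) (stat 1 0 n) / real n -
               measure_pmf.variance (table_pmf (1/2) n) (stat 0 1 n) / real n) / 2)
        \<longlonglongrightarrow> (V 1 1 - V 1 0 - V 0 1) / 2"
      by (intro tendsto_intros var) simp
    thus ?thesis
      unfolding covariance_pmf_polarization[OF finite_table_pmf] V_om o m om
      by (simp add: diff_divide_distrib mult.commute)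
  qed
  have e2: "(exp 1)\<^sup>2 = r ^ 4"
    by (simp add: e flip: power_mult)
  show ?thesis
    unfolding sqrt_e sqrt_e3 e2 unfolding e
  proof (intro conjI)
    show "(\<lambda>n. measure_pmf.expectation (table_pmf (1/2) n) (num_napkinless n))
        \<sim>[sequentially] (\<lambda>n. real n * (2 - r)\<^sup>2)"
      by (rule asymp_equiv_linearI[OF mean[of 1 0, folded o, unfolded f_o]]) (use pos in auto)
    show "(\<lambda>n. measure_pmf.expectation (table_pmf (1/2) n) (num_frustrated n))
        \<sim>[sequentially] (\<lambda>n. real n * (6 * r - r\<^sup>2 - 7))"
      by (rule asymp_equiv_linearI[OF mean[of 0 1, folded m, unfolded f_m]]) (use pos in auto)
    show "(\<lambda>n. measure_pmf.expectation (table_pmf (1/2) n) (num_happy n))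
        \<sim>[sequentially] (\<lambda>n. real n * (4 - 2 * r))"
      by (rule asymp_equiv_linearI[OF happy]) (use pos in auto)
    show "(\<lambda>n. measure_pmf.variance (table_pmf (1/2) n) (num_napkinless n))
        \<sim>[sequentially] (\<lambda>n. real n * (3 - r\<^sup>2) * (2 - r)\<^sup>2)"
      by (rule asymp_equiv_linearI[OF var[of 1 0, folded o, unfolded V_o]]) (use pos in auto)
    show "(\<lambda>n. measure_pmf.variance (table_pmf (1/2) n) (num_frustrated n))
        \<sim>[sequentially] (\<lambda>n. real n * (6 * r ^ 3 - r ^ 4 - r\<^sup>2 - 38 * r + 46))"
      by (rule asymp_equiv_linearI[OF var[of 0 1, folded m, unfolded V_m]]) (use pos in auto)
    show "(\<lambda>n. covariance_pmf (table_pmf (1/2) n) (num_napkinless n) (num_frustrated n))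
        \<sim>[sequentially] (\<lambda>n. - real n * (2 - r) * (r ^ 3 - 3 * r\<^sup>2 - 5 * r + 12))"
      by (rule asymp_equiv_linearI[OF cov])
         (use pos in simp, simp only: mult_minus_left mult_minus_right mult.assoc)
  qed
qed

end
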